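(* Let $M$ be an $n$-dimensional Hadamard manifold, let $f:M\to\mathbb{R}\cup\{+\infty\}$ be proper, let $p,q\in M$, and let $I:M\to M$ be an isometry such that $I(q)=p$. Then, for every $b\in M$ with $I(b)\in\operatorname{dom}f$ and every $u\in T_bM$, $$u\in\partial B^q(f\circ I)(b)\quad\Longleftrightarrow\quad DI_b(u)\in\partial B^p f(I(b)),$$ where $DI_b:T_bM\to T_{I(b)}M$ denotes the differential of $I$ at $b$.
   Context: A Hadamard manifold is a complete, simply connected Riemannian manifold of nonpositive sectional curvature; $d$ is its Riemannian distance and $\exp$ its exponential map (each $\exp_p$ is a diffeomorphism). A function $f:M\to\mathbb{R}\cup\{+\infty\}$ is proper if $\operatorname{dom}f=\{x: f(x)<+\infty\}\neq\varnothing$. For $q\in M$ and a unit vector $u\in T_qM$, $\gamma_{(q,u)}(t)=\exp_q(tu)$, $t\ge 0$, is the unit-speed geodesic ray from $q$ in direction $u$, and $B_u^q(x)=\lim_{t\to+\infty}\bigl(d(x,\gamma_{(q,u)}(t))-t\bigr)$ is the Busemann function. For a nonzero $u\in T_qM$, $B_u^q:=B_{u/\|u\|}^q$. Two unit-speed rays $\gamma,\sigma$ are asymptotic if $t\mapsto d(\gamma(t),\sigma(t))$ is bounded on $[0,\infty)$; for each ray and each point $q$ there is exactly one ray from $q$ asymptotic to it. The following definitions are used for an arbitrary base point $p\in M$ (in particular also with $q$ in place of $p$). Busemann coupling with base point $p$: $H_p:M\times M\to\mathbb{R}$, $H_p(z,y)=d(p,z)\,B^p_{-\exp_p^{-1}z}(y)$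 if $z\ne p$, and $H_p(p,y)=0$. For $x\in M$ and $v\in T_xM\setminus\{0\}$, $\eta_{p,x}(v)\in T_pM$ is the unique unit vector such that $\gamma_{(p,\eta_{p,x}(v))}$ and $\gamma_{(x,-v/\|v\|)}$ are asymptotic; $Y_p(x,v):=\exp_p(-\|v\|\,\eta_{p,x}(v))$ for $v\neq 0$ and $Y_p(x,0):=p$. $B^p$-subdifferential: for a proper function $f$ and $x\in\operatorname{dom}f$, $\partial B^p f(x)$ is the set of all $v\in T_xM$ such that $f(z)\ge f(x)+H_p(z,Y_p(x,v))-H_p(x,Y_p(x,v))$ for all $z\in M$. *)

theory Defs
  imports "HOL-Analysis.Analysis"
begin

section \<open>Smooth manifolds\<close>

text \<open>
  A manifold is the whole of a Hausdorff, second countable type \<open>'m\<close> together with a smooth atlas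
  modelled on \<open>real ^ 'n\<close>; its dimension is \<open>CARD('n)\<close>. A chart is a pair of a domain and a map,
  only the restriction of the map to the domain being relevant.
\<close>

type_synonym ('m, 'n) chart = "'m set \<times> ('m \<Rightarrow> real ^ 'n)"

definition chart_inv :: "('m, 'n::finite) chart \<Rightarrow> real ^ 'n \<Rightarrow> 'm" where
  "chart_inv c = inv_into (fst c) (snd c)"

text \<open>Iterated differentiability on an open set, phrased through directional derivatives so that
  the codomain stays the same: all derivatives up to order \<open>k\<close> exist and are continuous.\<close>

primrec Ck_smooth_on ::
    "nat \<Rightarrow> 'a::real_normed_vector set \<Rightarrow> ('a \<Rightarrow> 'b::real_normed_vector) \<Rightarrow> bool" where
  "Ck_smooth_on 0 S f \<longleftrightarrow> continuous_on S f"
| "Ck_smooth_on (Suc k) S f \<longleftrightarrow>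
     (\<forall>x\<in>S. f differentiable (at x)) \<and>
     (\<forall>v. Ck_smooth_on k S (\<lambda>x. frechet_derivative f (at x) v))"

definition smooth_on ::
    "'a::real_normed_vector set \<Rightarrow> ('a \<Rightarrow> 'b::real_normed_vector) \<Rightarrow> bool" where
  "smooth_on S f \<longleftrightarrow> (\<forall>k. Ck_smooth_on k S f)"

definition is_chart :: "('m::topological_space, 'n::finite) chart \<Rightarrow> bool" where
  "is_chart c \<longleftrightarrow> open (fst c) \<and> open (snd c ` fst c) \<and>
     homeomorphism (fst c) (snd c ` fst c) (snd c) (chart_inv c)"

definition smooth_atlas :: "('m::topological_space, 'n::finite) chart set \<Rightarrow> bool" where
  "smooth_atlas A \<longleftrightarrow>
     (\<forall>c\<in>A. is_chart c) \<and>
     (\<Union>c\<in>A. fst c) = UNIV \<and>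
     (\<forall>c\<in>A. \<forall>c'\<in>A. smooth_on (snd c ` (fst c \<inter> fst c')) (snd c' \<circ> chart_inv c))"

definition charts_at :: "('m, 'n::finite) chart set \<Rightarrow> 'm \<Rightarrow> ('m, 'n) chart set" where
  "charts_at A p = {c \<in> A. p \<in> fst c}"

definition chart_at :: "('m, 'n::finite) chart set \<Rightarrow> 'm \<Rightarrow> ('m, 'n) chart" where
  "chart_at A p = (SOME c. c \<in> charts_at A p)"

definition smooth_map ::
    "('m::topological_space, 'n::finite) chart set \<Rightarrow> ('m \<Rightarrow> 'm) \<Rightarrow> bool" where
  "smooth_map A F \<longleftrightarrow> continuous_on UNIV F \<and>
     (\<forall>c\<in>A. \<forall>c'\<in>A.
        smooth_on (snd c ` (fst c \<inter> F -` fst c')) (snd c' \<circ> F \<circ> chart_inv c))"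


section \<open>Tangent vectors\<close>

text \<open>
  A tangent vector at \<open>p\<close> is the family of its coordinate vectors in all charts around \<open>p\<close>, related
  by the derivatives of the transition maps; it is extended by \<open>0\<close> to the other charts, so that
  equal tangent vectors are equal functions.
\<close>

type_synonym ('m, 'n) tvector = "('m, 'n) chart \<Rightarrow> real ^ 'n"

definition tangent_space ::
    "('m, 'n::finite) chart set \<Rightarrow> 'm \<Rightarrow> ('m, 'n) tvector set" where
  "tangent_space A p = {v.
     (\<forall>c. c \<notin> charts_at A p \<longrightarrow> v c = 0) \<and>
     (\<forall>c\<in>charts_at A p. \<forall>c'\<in>charts_at A p.
        v c' = frechet_derivative (snd c' \<circ> chart_inv c) (at (snd c p)) (v c))}"

definition tzero :: "('m, 'n::finite) tvector" where
  "tzero = (\<lambda>c. 0)"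

definition tadd ::
    "('m, 'n::finite) tvector \<Rightarrow> ('m, 'n) tvector \<Rightarrow> ('m, 'n) tvector" where
  "tadd u v = (\<lambda>c. u c + v c)"

definition tscale :: "real \<Rightarrow> ('m, 'n::finite) tvector \<Rightarrow> ('m, 'n) tvector" where
  "tscale r v = (\<lambda>c. r *\<^sub>R v c)"

text \<open>The tangent vector at \<open>p\<close> whose coordinate vector in the chart \<open>c\<close> is \<open>a\<close>.\<close>

definition tvec ::
    "('m, 'n::finite) chart set \<Rightarrow> ('m, 'n) chart \<Rightarrow> 'm \<Rightarrow> real ^ 'n \<Rightarrow> ('m, 'n) tvector" where
  "tvec A c p a = (\<lambda>c'. if c' \<in> charts_at A p
     then frechet_derivative (snd c' \<circ> chart_inv c) (at (snd c p)) a else 0)"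

definition differential ::
    "('m, 'n::finite) chart set \<Rightarrow> ('m \<Rightarrow> 'm) \<Rightarrow> 'm \<Rightarrow> ('m, 'n) tvector \<Rightarrow> ('m, 'n) tvector" where
  "differential A F b u = (\<lambda>c'. if c' \<in> charts_at A (F b)
     then (let c = chart_at A b
           in frechet_derivative (snd c' \<circ> F \<circ> chart_inv c) (at (snd c b)) (u c))
     else 0)"

definition velocity ::
    "('m, 'n::finite) chart set \<Rightarrow> (real \<Rightarrow> 'm) \<Rightarrow> real \<Rightarrow> ('m, 'n) tvector" where
  "velocity A \<gamma> t = (\<lambda>c. if c \<in> charts_at A (\<gamma> t)
     then vector_derivative (snd c \<circ> \<gamma>) (at t) else 0)"


section \<open>Riemannian manifolds\<close>

type_synonym ('m, 'n) metric = "'m \<Rightarrow> ('m, 'n) tvector \<Rightarrow> ('m, 'n) tvector \<Rightarrow> real"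

definition gram ::
    "('m, 'n::finite) chart set \<Rightarrow> ('m, 'n) metric \<Rightarrow> ('m, 'n) chart \<Rightarrow> real ^ 'n \<Rightarrow> real ^ 'n ^ 'n"
  where
  "gram A g c y = (\<chi> i j. g (chart_inv c y)
     (tvec A c (chart_inv c y) (axis i 1)) (tvec A c (chart_inv c y) (axis j 1)))"

definition riemannian_metric ::
    "('m::topological_space, 'n::finite) chart set \<Rightarrow> ('m, 'n) metric \<Rightarrow> bool" where
  "riemannian_metric A g \<longleftrightarrow>
     (\<forall>p. \<forall>u\<in>tangent_space A p. \<forall>v\<in>tangent_space A p. g p u v = g p v u) \<and>
     (\<forall>p. \<forall>u\<in>tangent_space A p. \<forall>v\<in>tangent_space A p. \<forall>w\<in>tangent_space A p. \<forall>r s.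
        g p (tadd (tscale r u) (tscale s v)) w = r * g p u w + s * g p v w) \<and>
     (\<forall>p. \<forall>u\<in>tangent_space A p. u \<noteq> tzero \<longrightarrow> 0 < g p u u) \<and>
     (\<forall>c\<in>A. \<forall>i j. smooth_on (snd c ` fst c) (\<lambda>y. gram A g c y $ i $ j))"

definition riemannian_manifold ::
    "('m::{t2_space, second_countable_topology}, 'n::finite) chart set \<Rightarrow> ('m, 'n) metric \<Rightarrow> bool"
  where
  "riemannian_manifold A g \<longleftrightarrow> smooth_atlas A \<and> riemannian_metric A g"

definition tnorm :: "('m, 'n::finite) metric \<Rightarrow> 'm \<Rightarrow> ('m, 'n) tvector \<Rightarrow> real" where
  "tnorm g p v = sqrt (g p v v)"

text \<open>Riemannian distance: infimum of the lengths of piecewise \<open>C\<^sup>1\<close> curves on \<open>[0,1]\<close>. Each piece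
  is \<open>C\<^sup>1\<close> up to and including its end points.\<close>

definition C1_curve_on ::
    "('m::topological_space, 'n::finite) chart set \<Rightarrow> real set \<Rightarrow> (real \<Rightarrow> 'm) \<Rightarrow> bool" where
  "C1_curve_on A J \<gamma> \<longleftrightarrow> (\<forall>c\<in>A. \<exists>x'. continuous_on (J \<inter> \<gamma> -` fst c) x' \<and>
     (\<forall>t\<in>J \<inter> \<gamma> -` fst c. ((snd c \<circ> \<gamma>) has_vector_derivative x' t) (at t within J)))"

definition piecewise_C1_curve ::
    "('m::topological_space, 'n::finite) chart set \<Rightarrow> (real \<Rightarrow> 'm) \<Rightarrow> bool" where
  "piecewise_C1_curve A \<gamma> \<longleftrightarrow> continuous_on {0..1} \<gamma> \<and>
     (\<exists>D. D division_of {0..1} \<and> (\<forall>J\<in>D. C1_curve_on A J \<gamma>))"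

definition curve_length ::
    "('m, 'n::finite) chart set \<Rightarrow> ('m, 'n) metric \<Rightarrow> (real \<Rightarrow> 'm) \<Rightarrow> real" where
  "curve_length A g \<gamma> = integral {0..1} (\<lambda>t. tnorm g (\<gamma> t) (velocity A \<gamma> t))"

definition rdist ::
    "('m::topological_space, 'n::finite) chart set \<Rightarrow> ('m, 'n) metric \<Rightarrow> 'm \<Rightarrow> 'm \<Rightarrow> real" where
  "rdist A g x y = Inf {curve_length A g \<gamma> | \<gamma>. piecewise_C1_curve A \<gamma> \<and> \<gamma> 0 = x \<and> \<gamma> 1 = y}"

text \<open>\<open>partial h i y\<close> is the \<open>i\<close>-th partial derivative of \<open>h\<close> at \<open>y\<close>.\<close>

definition partial :: "(real ^ 'n \<Rightarrow> 'b::real_normed_vector) \<Rightarrow> 'n::finite \<Rightarrow> real ^ 'n \<Rightarrow> 'b" where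
  "partial h i y = frechet_derivative h (at y) (axis i 1)"

definition christoffel_symbol ::
    "('m, 'n::finite) chart set \<Rightarrow> ('m, 'n) metric \<Rightarrow> ('m, 'n) chart \<Rightarrow>
     'n \<Rightarrow> 'n \<Rightarrow> 'n \<Rightarrow> real ^ 'n \<Rightarrow> real" where
  "christoffel_symbol A g c k i j y =
     1/2 * (\<Sum>l\<in>UNIV. matrix_inv (gram A g c y) $ k $ l *
       (partial (\<lambda>z. gram A g c z $ j $ l) i y
        + partial (\<lambda>z. gram A g c z $ i $ l) j y
        - partial (\<lambda>z. gram A g c z $ i $ j) l y))"

text \<open>In coordinates, the value at \<open>y\<close> of the covariant derivative of the constant field \<open>b\<close> in
  the direction \<open>a\<close>.\<close>

definition christoffel ::
    "('m, 'n::finite) chart set \<Rightarrow> ('m, 'n) metric \<Rightarrow> ('m, 'n) chart \<Rightarrow>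
     real ^ 'n \<Rightarrow> real ^ 'n \<Rightarrow> real ^ 'n \<Rightarrow> real ^ 'n" where
  "christoffel A g c y a b =
     (\<chi> k. \<Sum>i\<in>UNIV. \<Sum>j\<in>UNIV. christoffel_symbol A g c k i j y * a $ i * b $ j)"

text \<open>Geodesics defined on all of \<open>\<real>\<close>; the geodesic equation is required in every chart.\<close>

definition geodesic ::
    "('m::topological_space, 'n::finite) chart set \<Rightarrow> ('m, 'n) metric \<Rightarrow> (real \<Rightarrow> 'm) \<Rightarrow> bool" where
  "geodesic A g \<gamma> \<longleftrightarrow> continuous_on UNIV \<gamma> \<and>
     (\<forall>c\<in>A. \<exists>x'. \<forall>t. \<gamma> t \<in> fst c \<longrightarrow>
        ((snd c \<circ> \<gamma>) has_vector_derivative x' t) (at t) \<and>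
        (x' has_vector_derivative - christoffel A g c (snd c (\<gamma> t)) (x' t) (x' t)) (at t))"

text \<open>The curvature tensor \<open>R(a,b)w = \<nabla>\<^sub>a \<nabla>\<^sub>b w - \<nabla>\<^sub>b \<nabla>\<^sub>a w\<close> (constant fields \<open>a\<close>, \<open>b\<close> commute) in
  the chart \<open>c\<close>.\<close>

definition curvature ::
    "('m, 'n::finite) chart set \<Rightarrow> ('m, 'n) metric \<Rightarrow> ('m, 'n) chart \<Rightarrow>
     real ^ 'n \<Rightarrow> real ^ 'n \<Rightarrow> real ^ 'n \<Rightarrow> real ^ 'n \<Rightarrow> real ^ 'n" where
  "curvature A g c y a b w =
     frechet_derivative (\<lambda>z. christoffel A g c z b w) (at y) a
     - frechet_derivative (\<lambda>z. christoffel A g c z a w) (at y) b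
     + christoffel A g c y a (christoffel A g c y b w)
     - christoffel A g c y b (christoffel A g c y a w)"

text \<open>The value does not depend on the chart, since \<open>R\<close> is a tensor.\<close>

definition sectional_curvature ::
    "('m, 'n::finite) chart set \<Rightarrow> ('m, 'n) metric \<Rightarrow> 'm \<Rightarrow>
     ('m, 'n) tvector \<Rightarrow> ('m, 'n) tvector \<Rightarrow> real" where
  "sectional_curvature A g p u v =
     (let c = chart_at A p
      in g p (tvec A c p (curvature A g c (snd c p) (u c) (v c) (v c))) u
         / (g p u u * g p v v - (g p u v)\<^sup>2))"

definition tindependent :: "('m, 'n::finite) tvector \<Rightarrow> ('m, 'n) tvector \<Rightarrow> bool" where
  "tindependent u v \<longleftrightarrow> (\<forall>r s. tadd (tscale r u) (tscale s v) = tzero \<longrightarrow> r = 0 \<and> s = 0)"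

definition nonpositively_curved ::
    "('m, 'n::finite) chart set \<Rightarrow> ('m, 'n) metric \<Rightarrow> bool" where
  "nonpositively_curved A g \<longleftrightarrow>
     (\<forall>p. \<forall>u\<in>tangent_space A p. \<forall>v\<in>tangent_space A p.
        tindependent u v \<longrightarrow> sectional_curvature A g p u v \<le> 0)"

definition geodesically_complete ::
    "('m::topological_space, 'n::finite) chart set \<Rightarrow> ('m, 'n) metric \<Rightarrow> bool" where
  "geodesically_complete A g \<longleftrightarrow>
     (\<forall>p. \<forall>v\<in>tangent_space A p. \<exists>\<gamma>. geodesic A g \<gamma> \<and> \<gamma> 0 = p \<and> velocity A \<gamma> 0 = v)"

definition hadamard_manifold ::
    "('m::{t2_space, second_countable_topology}, 'n::finite) chart set \<Rightarrow> ('m, 'n) metric \<Rightarrow> bool"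
  where
  "hadamard_manifold A g \<longleftrightarrow>
     riemannian_manifold A g \<and> geodesically_complete A g \<and>
     simply_connected (UNIV :: 'm set) \<and> nonpositively_curved A g"

definition riemannian_isometry ::
    "('m::topological_space, 'n::finite) chart set \<Rightarrow> ('m, 'n) metric \<Rightarrow> ('m \<Rightarrow> 'm) \<Rightarrow> bool" where
  "riemannian_isometry A g F \<longleftrightarrow>
     bij F \<and> smooth_map A F \<and> smooth_map A (inv F) \<and>
     (\<forall>x. \<forall>u\<in>tangent_space A x. \<forall>v\<in>tangent_space A x.
        g (F x) (differential A F x u) (differential A F x v) = g x u v)"


section \<open>Exponential map, Busemann functions and the subdifferential\<close>

text \<open>The unique element satisfying \<open>P\<close>. On a Hadamard manifold uniqueness and existence hold in
  all uses below at tangent vectors (\<open>v \<noteq> 0\<close> for the asymptotic direction), so that the default \<open>d\<close>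
  never occurs there; it only makes the functions total.\<close>

definition the_or :: "'a \<Rightarrow> ('a \<Rightarrow> bool) \<Rightarrow> 'a" where
  "the_or d P = (if \<exists>!x. P x then THE x. P x else d)"

definition rexp ::
    "('m::topological_space, 'n::finite) chart set \<Rightarrow> ('m, 'n) metric \<Rightarrow> 'm \<Rightarrow> ('m, 'n) tvector \<Rightarrow> 'm"
  where
  "rexp A g p v = the_or (\<lambda>t. p) (\<lambda>\<gamma>. geodesic A g \<gamma> \<and> \<gamma> 0 = p \<and> velocity A \<gamma> 0 = v) 1"

definition exp_inv ::
    "('m::topological_space, 'n::finite) chart set \<Rightarrow> ('m, 'n) metric \<Rightarrow> 'm \<Rightarrow> 'm \<Rightarrow> ('m, 'n) tvector"
  where
  "exp_inv A g p z = the_or tzero (\<lambda>v. v \<in> tangent_space A p \<and> rexp A g p v = z)"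

definition ray ::
    "('m::topological_space, 'n::finite) chart set \<Rightarrow> ('m, 'n) metric \<Rightarrow>
     'm \<Rightarrow> ('m, 'n) tvector \<Rightarrow> real \<Rightarrow> 'm" where
  "ray A g q u t = rexp A g q (tscale t u)"

definition asymptotic ::
    "('m::topological_space, 'n::finite) chart set \<Rightarrow> ('m, 'n) metric \<Rightarrow>
     (real \<Rightarrow> 'm) \<Rightarrow> (real \<Rightarrow> 'm) \<Rightarrow> bool" where
  "asymptotic A g \<gamma> \<sigma> \<longleftrightarrow> bounded ((\<lambda>t. rdist A g (\<gamma> t) (\<sigma> t)) ` {0..})"

text \<open>For nonzero \<open>u\<close>; the direction is normalised.\<close>

definition busemann ::
    "('m::topological_space, 'n::finite) chart set \<Rightarrow> ('m, 'n) metric \<Rightarrow>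
     'm \<Rightarrow> ('m, 'n) tvector \<Rightarrow> 'm \<Rightarrow> real" where
  "busemann A g q u x =
     Lim at_top (\<lambda>t. rdist A g x (ray A g q (tscale (1 / tnorm g q u) u) t) - t)"

definition busemann_coupling ::
    "('m::topological_space, 'n::finite) chart set \<Rightarrow> ('m, 'n) metric \<Rightarrow> 'm \<Rightarrow> 'm \<Rightarrow> 'm \<Rightarrow> real"
  where
  "busemann_coupling A g p z y =
     (if z = p then 0
      else rdist A g p z * busemann A g p (tscale (- 1) (exp_inv A g p z)) y)"

definition asymptotic_direction ::
    "('m::topological_space, 'n::finite) chart set \<Rightarrow> ('m, 'n) metric \<Rightarrow>
     'm \<Rightarrow> 'm \<Rightarrow> ('m, 'n) tvector \<Rightarrow> ('m, 'n) tvector" where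
  "asymptotic_direction A g p x v = the_or tzero (\<lambda>\<eta>.
     \<eta> \<in> tangent_space A p \<and> tnorm g p \<eta> = 1 \<and>
     asymptotic A g (ray A g p \<eta>) (ray A g x (tscale (- 1 / tnorm g x v) v)))"

definition Y_point ::
    "('m::topological_space, 'n::finite) chart set \<Rightarrow> ('m, 'n) metric \<Rightarrow>
     'm \<Rightarrow> 'm \<Rightarrow> ('m, 'n) tvector \<Rightarrow> 'm" where
  "Y_point A g p x v =
     (if v = tzero then p
      else rexp A g p (tscale (- tnorm g x v) (asymptotic_direction A g p x v)))"

definition edom :: "('m \<Rightarrow> ereal) \<Rightarrow> 'm set" where
  "edom f = {x. f x < \<infinity>}"

text \<open>\<open>f\<close> takes values in \<open>\<real> \<union> {+\<infinity>}\<close> and has nonempty domain.\<close>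

definition proper_function :: "('m \<Rightarrow> ereal) \<Rightarrow> bool" where
  "proper_function f \<longleftrightarrow> (\<forall>x. f x \<noteq> -\<infinity>) \<and> edom f \<noteq> {}"

definition busemann_subdifferential ::
    "('m::topological_space, 'n::finite) chart set \<Rightarrow> ('m, 'n) metric \<Rightarrow>
     'm \<Rightarrow> ('m \<Rightarrow> ereal) \<Rightarrow> 'm \<Rightarrow> ('m, 'n) tvector set" where
  "busemann_subdifferential A g p f x = {v \<in> tangent_space A x. \<forall>z.
     f z \<ge> f x + ereal (busemann_coupling A g p z (Y_point A g p x v)
                        - busemann_coupling A g p x (Y_point A g p x v))}"

end

theory Submission
  imports Defs
begin

text \<open>
  Every notion entering the subdifferential is natural under isometries. Differentiating the pullback
  identity for the metric in charts and inserting it into the Koszul formula gives the transformation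
  law of the Christoffel symbols, so an isometry maps geodesics to geodesics; it also preserves the
  lengths of curves. Objects defined by unique existence are transported along the bijections
  \<open>\<gamma> \<mapsto> I \<circ> \<gamma>\<close> and \<open>v \<mapsto> DI v\<close>. These bijections match
  the default values of \<^const>\<open>the_or\<close> as well, so that no existence or uniqueness result for
  geodesics, logarithms or asymptotic rays is needed.
\<close>

section \<open>Symmetry of second derivatives\<close>

text \<open>In coordinates the pulled-back metric depends on the point both through the Gram matrix
  and through the derivative of the isometry's local representative. Differentiating it leaves
  second derivatives of that representative, which have no counterpart in the Koszul formula.
  Symmetry of second derivatives cancels all of them except one, doubled; this survivor is the
  inhomogeneous term of the Christoffel law, and along a curve it cancels against the second-order
  term of the chain rule. Hence a Schwarz theorem for the notion of smoothness at hand. Two devices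
  shorten the rest: transition maps are the local representatives of \<open>id\<close>, so one chain
  rule covers chart changes and differentials alike, and the inverse of an isometry is an isometry,
  so one-sided statements yield two-sided ones.\<close>

lemma smooth_on_differentiable: "smooth_on S f \<Longrightarrow> x \<in> S \<Longrightarrow> f differentiable (at x)"
  unfolding smooth_on_def by (drule spec[of _ "Suc 0"]) simp

lemma smooth_on_frechet_derivative:
  "smooth_on S f \<Longrightarrow> smooth_on S (\<lambda>x. frechet_derivative f (at x) v)"
  unfolding smooth_on_def using Ck_smooth_on.simps(2) by blast

lemma smooth_on_continuous_on: "smooth_on S f \<Longrightarrow> continuous_on S f"
  unfolding smooth_on_def by (drule spec[of _ 0]) simp

lemma smooth_on_has_derivative:
  "smooth_on S f \<Longrightarrow> x \<in> S \<Longrightarrow> (f has_derivative frechet_derivative f (at x)) (at x)"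
  using smooth_on_differentiable frechet_derivative_works by blast

lemma differentiable_inner_left:
  assumes "f differentiable F"
  shows "(\<lambda>x. f x \<bullet> b) differentiable F"
proof -
  obtain D where "(f has_derivative D) F" using assms unfolding differentiable_def ..
  from has_derivative_inner_left[OF this] show ?thesis by (rule differentiableI)
qed

lemma frechet_derivative_inner:
  assumes "f differentiable (at x)"
  shows "frechet_derivative (\<lambda>z. f z \<bullet> b) (at x) v = frechet_derivative f (at x) v \<bullet> b"
  using frechet_derivative_at[OF has_derivative_inner_left[OF
      assms[unfolded frechet_derivative_works]], of b] by metis

text \<open>Restricting \<open>f\<close> to a line makes the one-variable mean value theorem
  available for directional derivatives.\<close>

lemma has_real_derivative_along_line:
  fixes f :: "'a::real_normed_vector \<Rightarrow> real"
  assumes "f differentiable (at (x + t *\<^sub>R v))"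
  shows "((\<lambda>s. f (x + s *\<^sub>R v)) has_real_derivative frechet_derivative f (at (x + t *\<^sub>R v)) v) (at t)"
proof -
  let ?D = "frechet_derivative f (at (x + t *\<^sub>R v))"
  have D: "(f has_derivative ?D) (at (x + t *\<^sub>R v))"
    using assms frechet_derivative_works by blast
  have "((\<lambda>s. x + s *\<^sub>R v) has_derivative (\<lambda>s. s *\<^sub>R v)) (at t)"
    by (auto intro!: derivative_eq_intros)
  from has_derivative_compose[OF this D]
  have "((\<lambda>s. f (x + s *\<^sub>R v)) has_derivative (\<lambda>s. ?D (s *\<^sub>R v))) (at t)" .
  moreover have "?D (s *\<^sub>R v) = ?D v * s" for s
    using linear_cmul[OF linear_frechet_derivative[OF assms]] by simp
  ultimately show ?thesis by (simp add: has_field_derivative_def)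
qed

text \<open>The mean value theorem is applied along \<open>v\<close> and then along
  \<open>w\<close>. The second difference on the left is symmetric in \<open>v\<close> and
  \<open>w\<close>, while the derivatives on the right are taken in a fixed order; this contrast
  yields the symmetry of second derivatives.\<close>

lemma mixed_difference_mvt:
  fixes f :: "'a::real_normed_vector \<Rightarrow> real"
  assumes f: "smooth_on S f" and s: "0 < s"
    and sub: "\<And>a b. a \<in> {0..s} \<Longrightarrow> b \<in> {0..s} \<Longrightarrow> y + a *\<^sub>R v + b *\<^sub>R w \<in> S"
  shows "\<exists>a\<in>{0..s}. \<exists>b\<in>{0..s}.
    f (y + s *\<^sub>R v + s *\<^sub>R w) - f (y + s *\<^sub>R v) - f (y + s *\<^sub>R w) + f y
    = s * s * frechet_derivative (\<lambda>z. frechet_derivative f (at z) v) (at (y + a *\<^sub>R v + b *\<^sub>R w)) w"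
proof -
  let ?D = "\<lambda>z. frechet_derivative f (at z) v"
  \<comment> \<open>\<open>?h\<close> is the increment of \<open>f\<close> across the parallelogram
    in direction \<open>w\<close>; its own increment over \<open>{0..s}\<close> is the second
    difference.\<close>
  let ?h = "\<lambda>t. f (y + s *\<^sub>R w + t *\<^sub>R v) - f (y + t *\<^sub>R v)"
  have "\<exists>a>0. a < s \<and> ?h s - ?h 0 = (s - 0) * (?D (y + s *\<^sub>R w + a *\<^sub>R v) - ?D (y + a *\<^sub>R v))"
  proof (rule MVT2[OF s])
    fix t assume t: "0 \<le> t" "t \<le> s"
    have "y + s *\<^sub>R w + t *\<^sub>R v \<in> S" "y + t *\<^sub>R v \<in> S"
      using sub[of t s] sub[of t 0] t s by (auto simp: algebra_simps)
    then show "DERIV ?h t :> ?D (y + s *\<^sub>R w + t *\<^sub>R v) - ?D (y + t *\<^sub>R v)"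
      by (intro DERIV_diff has_real_derivative_along_line smooth_on_differentiable[OF f])
  qed
  then obtain a where a: "0 < a" "a < s"
    "?h s - ?h 0 = s * (?D (y + s *\<^sub>R w + a *\<^sub>R v) - ?D (y + a *\<^sub>R v))" by auto
  let ?k = "\<lambda>t. ?D (y + a *\<^sub>R v + t *\<^sub>R w)"
  have "\<exists>b>0. b < s \<and> ?k s - ?k 0 = (s - 0) * frechet_derivative ?D (at (y + a *\<^sub>R v + b *\<^sub>R w)) w"
  proof (rule MVT2[OF s])
    fix t assume t: "0 \<le> t" "t \<le> s"
    then show "DERIV ?k t :> frechet_derivative ?D (at (y + a *\<^sub>R v + t *\<^sub>R w)) w"
      using sub[of a t] a
      by (intro has_real_derivative_along_line
          smooth_on_differentiable[OF smooth_on_frechet_derivative[OF f]]) auto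
  qed
  then obtain b where b: "0 < b" "b < s"
    "?k s - ?k 0 = s * frechet_derivative ?D (at (y + a *\<^sub>R v + b *\<^sub>R w)) w" by auto
  have "f (y + s *\<^sub>R v + s *\<^sub>R w) - f (y + s *\<^sub>R v) - f (y + s *\<^sub>R w) + f y = ?h s - ?h 0"
    by (simp add: add_ac)
  also have "\<dots> = s * (?k s - ?k 0)" using a(3) by (simp add: add_ac)
  also have "\<dots> = s * s * frechet_derivative ?D (at (y + a *\<^sub>R v + b *\<^sub>R w)) w"
    using b(3) by simp
  finally show ?thesis using a b by (intro bexI[of _ a] bexI[of _ b]) auto
qed

text \<open>Both mixed derivatives, evaluated at suitable points of one small parallelogram, equal
  the same second difference divided by \<open>s * s\<close>. Continuity at \<open>y\<close> then
  excludes any gap between their values there.\<close>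

lemma second_derivative_symmetric_real:
  fixes f :: "'a::real_normed_vector \<Rightarrow> real"
  assumes f: "smooth_on S f" and S: "open S" "y \<in> S"
  shows "frechet_derivative (\<lambda>z. frechet_derivative f (at z) v) (at y) w
    = frechet_derivative (\<lambda>z. frechet_derivative f (at z) w) (at y) v" (is "?P y = ?Q y")
proof (rule ccontr)
  assume ne: "?P y \<noteq> ?Q y"
  \<comment> \<open>Half the gap: two errors below \<open>e\<close> cannot add up to it.\<close>
  define e where "e = \<bar>?P y - ?Q y\<bar> / 2"
  have e: "e > 0" using ne by (simp add: e_def)
  have "continuous_on S ?P" "continuous_on S ?Q"
    by (intro smooth_on_continuous_on smooth_on_frechet_derivative f)+
  then have "isCont ?P y" "isCont ?Q y" using S continuous_on_eq_continuous_at by blast+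
  obtain d1 where d1: "d1 > 0" "\<And>z. dist z y < d1 \<Longrightarrow> dist (?P z) (?P y) < e"
    using \<open>isCont ?P y\<close> e unfolding continuous_at_eps_delta by blast
  obtain d2 where d2: "d2 > 0" "\<And>z. dist z y < d2 \<Longrightarrow> dist (?Q z) (?Q y) < e"
    using \<open>isCont ?Q y\<close> e unfolding continuous_at_eps_delta by blast
  obtain d3 where d3: "d3 > 0" "ball y d3 \<subseteq> S" using S openE by blast
  define r where "r = min d1 (min d2 d3)"
  have r: "r > 0" using d1(1) d2(1) d3(1) by (simp add: r_def)
  \<comment> \<open>Points of the parallelogram lie within \<open>s * (norm v + norm w)\<close> of
    \<open>y\<close>, which is less than \<open>r\<close>; the summand 1 keeps the denominator
    positive when both vectors vanish.\<close>
  define s where "s = r / (2 * (norm v + norm w + 1))"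
  have s: "s > 0" using r by (simp add: s_def add_nonneg_pos)
  have close: "dist (y + a *\<^sub>R v + b *\<^sub>R w) y < r" if "a \<in> {0..s}" "b \<in> {0..s}" for a b
  proof -
    have "dist (y + a *\<^sub>R v + b *\<^sub>R w) y = norm (a *\<^sub>R v + b *\<^sub>R w)"
      by (simp add: dist_norm add_ac)
    also have "\<dots> \<le> norm (a *\<^sub>R v) + norm (b *\<^sub>R w)" by (rule norm_triangle_ineq)
    also have "\<dots> \<le> s * norm v + s * norm w"
      using that by (auto intro!: add_mono mult_right_mono)
    also have "\<dots> < s * (2 * (norm v + norm w + 1))"
    proof -
      have "0 \<le> s * (norm v + norm w)" using s by simp
      then have "0 < s * (norm v + norm w) + 2 * s" using s by linarith
      then show ?thesis by (simp add: algebra_simps)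
    qed
    also have "\<dots> = r"
    proof -
      have "0 < 2 * (norm v + norm w + 1)" by (simp add: add_nonneg_pos)
      then show ?thesis by (simp add: s_def)
    qed
    finally show ?thesis .
  qed
  have sub: "y + a *\<^sub>R v + b *\<^sub>R w \<in> S" if "a \<in> {0..s}" "b \<in> {0..s}" for a b
    using close[OF that] d3(2) by (auto simp: r_def dist_commute subset_iff)
  obtain a b where ab: "a \<in> {0..s}" "b \<in> {0..s}"
    "f (y + s *\<^sub>R v + s *\<^sub>R w) - f (y + s *\<^sub>R v) - f (y + s *\<^sub>R w) + f y
    = s * s * ?P (y + a *\<^sub>R v + b *\<^sub>R w)"
    using mixed_difference_mvt[OF f s, of y v w] sub by blast
  have sub': "y + a *\<^sub>R w + b *\<^sub>R v \<in> S" if "a \<in> {0..s}" "b \<in> {0..s}" for a b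
    using sub[OF that(2,1)] by (simp add: add_ac)
  obtain a' b' where ab': "a' \<in> {0..s}" "b' \<in> {0..s}"
    "f (y + s *\<^sub>R w + s *\<^sub>R v) - f (y + s *\<^sub>R w) - f (y + s *\<^sub>R v) + f y
    = s * s * ?Q (y + a' *\<^sub>R w + b' *\<^sub>R v)"
    using mixed_difference_mvt[OF f s, of y w v] sub' by blast
  have c': "dist (y + a' *\<^sub>R w + b' *\<^sub>R v) y < r" using close[OF ab'(2,1)] by (simp add: add_ac)
  have "y + s *\<^sub>R w + s *\<^sub>R v = y + s *\<^sub>R v + s *\<^sub>R w" by (rule add.assoc[THEN trans]) (simp add: add_ac)
  then have "s * s * ?P (y + a *\<^sub>R v + b *\<^sub>R w) = s * s * ?Q (y + a' *\<^sub>R w + b' *\<^sub>R v)"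
    using ab(3) ab'(3) by (simp only:)
  then have "?P (y + a *\<^sub>R v + b *\<^sub>R w) = ?Q (y + a' *\<^sub>R w + b' *\<^sub>R v)"
    using s by (simp only: mult_cancel_left) auto
  moreover have "dist (?P (y + a *\<^sub>R v + b *\<^sub>R w)) (?P y) < e"
    using d1(2) close[OF ab(1,2)] by (simp add: r_def)
  moreover have "dist (?Q (y + a' *\<^sub>R w + b' *\<^sub>R v)) (?Q y) < e"
    using d2(2) c' by (simp add: r_def)
  ultimately show False unfolding e_def dist_real_def by (auto simp: abs_if split: if_splits)
qed

text \<open>Differentiability \<open>at x\<close> refers to a full neighbourhood, so agreement on
  \<open>S\<close> passes to the derivatives because \<open>S\<close> is open. The induction varies
  both functions, since the next order concerns their directional derivatives.\<close>

lemma Ck_smooth_on_cong: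
  assumes "open S" "\<And>x. x \<in> S \<Longrightarrow> f x = g x" "Ck_smooth_on k S f"
  shows "Ck_smooth_on k S g"
  using assms(2,3)
proof (induction k arbitrary: f g)
  case 0
  then show ?case using continuous_on_cong by (metis Ck_smooth_on.simps(1))
next
  case (Suc k)
  have "g differentiable (at x)" if "x \<in> S" for x
    using Suc.prems that assms(1) unfolding Ck_smooth_on.simps differentiable_def
    by (meson has_derivative_transform_within_open)
  moreover have "frechet_derivative f (at x) v = frechet_derivative g (at x) v" if "x \<in> S" for x v
    using frechet_derivative_transform_within_open[of f x S g] Suc.prems that assms(1) by simp
  ultimately show ?case using Suc.IH[OF _ Suc.prems(2)[simplified, THEN conjunct2, rule_format]]
    by simp
qed

lemma Ck_smooth_on_inner:
  assumes "open S" "Ck_smooth_on k S f"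
  shows "Ck_smooth_on k S (\<lambda>x. f x \<bullet> b)"
  using assms(2)
proof (induction k arbitrary: f)
  case 0
  then show ?case by (auto intro!: continuous_intros)
next
  case (Suc k)
  have "(\<lambda>x. f x \<bullet> b) differentiable (at x)" if "x \<in> S" for x
    using Suc.prems that by (auto intro: differentiable_inner_left)
  moreover have "Ck_smooth_on k S (\<lambda>x. frechet_derivative (\<lambda>z. f z \<bullet> b) (at x) v)" for v
    \<comment> \<open>Derivative and inner product are known to commute only at points of
      \<open>S\<close>, where \<open>f\<close> is differentiable; hence the detour through
      congruence.\<close>
    by (rule Ck_smooth_on_cong[OF assms(1) _ Suc.IH[of "\<lambda>x. frechet_derivative f (at x) v"]])
      (use Suc.prems in \<open>auto simp: frechet_derivative_inner\<close>)
  ultimately show ?case by auto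
qed

text \<open>The mean value argument is confined to real values; inner products with basis vectors
  reduce the general codomain to it.\<close>

lemma second_derivative_symmetric:
  fixes f :: "'a::real_normed_vector \<Rightarrow> 'b::euclidean_space"
  assumes f: "smooth_on S f" and S: "open S" "y \<in> S"
  shows "frechet_derivative (\<lambda>z. frechet_derivative f (at z) v) (at y) w
    = frechet_derivative (\<lambda>z. frechet_derivative f (at z) w) (at y) v"
proof (rule euclidean_eqI)
  fix b :: 'b
  have eq: "frechet_derivative (\<lambda>z. frechet_derivative f (at z) v) (at y) w \<bullet> b =
     frechet_derivative (\<lambda>z. frechet_derivative (\<lambda>z. f z \<bullet> b) (at z) v) (at y) w" for v w
  proof -
    have 1: "(\<lambda>z. frechet_derivative f (at z) v) differentiable (at y)"
      by (rule smooth_on_differentiable[OF smooth_on_frechet_derivative[OF f] S(2)])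
    have "frechet_derivative (\<lambda>z. frechet_derivative f (at z) v) (at y) w \<bullet> b
      = frechet_derivative (\<lambda>z. frechet_derivative f (at z) v \<bullet> b) (at y) w"
      by (rule frechet_derivative_inner[OF 1, symmetric])
    also have "frechet_derivative (\<lambda>z. frechet_derivative f (at z) v \<bullet> b) (at y)
       = frechet_derivative (\<lambda>z. frechet_derivative (\<lambda>z. f z \<bullet> b) (at z) v) (at y)"
    proof (rule frechet_derivative_transform_within_open[OF _ S])
      show "(\<lambda>z. frechet_derivative f (at z) v \<bullet> b) differentiable at y"
        by (rule differentiable_inner_left[OF 1])
      show "frechet_derivative f (at x) v \<bullet> b = frechet_derivative (\<lambda>z. f z \<bullet> b) (at x) v"
        if "x \<in> S" for x
        by (simp add: frechet_derivative_inner[OF smooth_on_differentiable[OF f that]])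
    qed
    finally show ?thesis .
  qed
  have "smooth_on S (\<lambda>z. f z \<bullet> b)"
    using Ck_smooth_on_inner[OF S(1)] f unfolding smooth_on_def by blast
  from second_derivative_symmetric_real[OF this S]
  show "frechet_derivative (\<lambda>z. frechet_derivative f (at z) v) (at y) w \<bullet> b
    = frechet_derivative (\<lambda>z. frechet_derivative f (at z) w) (at y) v \<bullet> b"
    by (simp add: eq)
qed


section \<open>Local representatives of smooth maps and the chain rule\<close>

text \<open>For \<open>F = id\<close> this is the transition map from \<open>c\<close> to
  \<open>c'\<close>, so chart changes are instances of statements on smooth maps.\<close>

abbreviation local_rep ::
    "('m \<Rightarrow> 'm) \<Rightarrow> ('m, 'n::finite) chart \<Rightarrow> ('m, 'n) chart \<Rightarrow> real ^ 'n \<Rightarrow> real ^ 'n" where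
  "local_rep F c c' \<equiv> snd c' \<circ> F \<circ> chart_inv c"

abbreviation local_diff ::
    "('m \<Rightarrow> 'm) \<Rightarrow> ('m, 'n::finite) chart \<Rightarrow> ('m, 'n) chart \<Rightarrow> 'm \<Rightarrow> real ^ 'n \<Rightarrow> real ^ 'n" where
  "local_diff F c c' x \<equiv> frechet_derivative (local_rep F c c') (at (snd c x))"

locale smooth_manifold =
  fixes A :: "('m::t2_space, 'n::finite) chart set"
  assumes smooth_atlas: "smooth_atlas A"
begin

lemma is_chart: "c \<in> A \<Longrightarrow> is_chart c"
  using smooth_atlas unfolding smooth_atlas_def by blast

lemma open_chart_domain: "c \<in> A \<Longrightarrow> open (fst c)"
  using is_chart by (auto simp: is_chart_def)

lemma charts_atD: "c \<in> charts_at A x \<Longrightarrow> c \<in> A" "c \<in> charts_at A x \<Longrightarrow> x \<in> fst c"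
  by (auto simp: charts_at_def)

lemma charts_atI: "c \<in> A \<Longrightarrow> x \<in> fst c \<Longrightarrow> c \<in> charts_at A x"
  by (auto simp: charts_at_def)

lemma chart_at: "chart_at A x \<in> charts_at A x"
proof -
  have "x \<in> (\<Union>c\<in>A. fst c)" using smooth_atlas by (auto simp: smooth_atlas_def)
  then have "\<exists>c. c \<in> charts_at A x" by (auto simp: charts_at_def)
  then show ?thesis unfolding chart_at_def by (rule someI_ex)
qed

lemma chart_inv_chart: "c \<in> A \<Longrightarrow> x \<in> fst c \<Longrightarrow> chart_inv c (snd c x) = x"
  using is_chart[of c] homeomorphism_apply1 unfolding is_chart_def by blast

lemma chart_inv_chart_at: "c \<in> charts_at A x \<Longrightarrow> y \<in> fst c \<Longrightarrow> chart_inv c (snd c y) = y"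
  by (rule chart_inv_chart[OF charts_atD(1)])

text \<open>The image is the preimage of \<open>U\<close> under the chart inverse, which is
  continuous on an open set.\<close>

lemma open_chart_image:
  assumes "c \<in> A" "open U"
  shows "open (snd c ` (fst c \<inter> U))"
proof -
  have "open (snd c ` fst c)" "continuous_on (snd c ` fst c) (chart_inv c)"
    using is_chart[OF assms(1)] unfolding is_chart_def homeomorphism_def by blast+
  then have "open (snd c ` fst c \<inter> chart_inv c -` U)"
    using assms(2) by (intro continuous_open_preimage)
  also have "snd c ` fst c \<inter> chart_inv c -` U = snd c ` (fst c \<inter> U)"
    by (auto simp: chart_inv_chart[OF assms(1)])
  finally show ?thesis .
qed

lemma smooth_map_id: "smooth_map A id"
  using smooth_atlas by (simp add: smooth_map_def smooth_atlas_def)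

lemma smooth_map_isCont: "smooth_map A F \<Longrightarrow> isCont F x"
  by (simp add: smooth_map_def continuous_on_eq_continuous_at)

lemma open_local_rep_domain:
  assumes "smooth_map A F" "c \<in> A" "c' \<in> A"
  shows "open (snd c ` (fst c \<inter> F -` fst c'))"
  using assms by (intro open_chart_image open_vimage open_chart_domain) (auto simp: smooth_map_def)

lemma smooth_on_local_rep:
  "smooth_map A F \<Longrightarrow> c \<in> A \<Longrightarrow> c' \<in> A \<Longrightarrow>
    smooth_on (snd c ` (fst c \<inter> F -` fst c')) (local_rep F c c')"
  by (auto simp: smooth_map_def)

lemma has_derivative_local_rep:
  assumes "smooth_map A F" "c \<in> charts_at A x" "c' \<in> charts_at A (F x)"
  shows "(local_rep F c c' has_derivative local_diff F c c' x) (at (snd c x))"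
  using charts_atD(1)[OF assms(2)] charts_atD(1)[OF assms(3)]
    charts_atD(2)[OF assms(2)] charts_atD(2)[OF assms(3)] assms(1)
  by (intro smooth_on_has_derivative[OF smooth_on_local_rep]) auto

lemma linear_local_diff:
  assumes "smooth_map A F" "c \<in> charts_at A x" "c' \<in> charts_at A (F x)"
  shows "linear (local_diff F c c' x)"
  by (rule has_derivative_linear[OF has_derivative_local_rep[OF assms]])

text \<open>With \<open>F\<close> or \<open>G\<close> equal to \<open>id\<close> this is a change of
  chart in the source or in the target.\<close>

lemma local_diff_comp:
  assumes F: "smooth_map A F" and G: "smooth_map A G"
    and c: "c \<in> charts_at A x" "c' \<in> charts_at A (F x)" "c'' \<in> charts_at A (G (F x))"
  shows "local_diff (G \<circ> F) c c'' x a = local_diff G c' c'' (F x) (local_diff F c c' x a)"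
proof -
  have inv: "chart_inv c (snd c x) = x" by (rule chart_inv_chart_at[OF c(1) charts_atD(2)[OF c(1)]])
  have eq: "snd c' (F x) = local_rep F c c' (snd c x)" by (simp add: inv)
  have "(local_rep G c' c'' has_derivative local_diff G c' c'' (F x)) (at (local_rep F c c' (snd c x)))"
    using has_derivative_local_rep[OF G c(2,3)] eq by simp
  from has_derivative_compose[OF has_derivative_local_rep[OF F c(1,2)] this]
  have "((\<lambda>y. local_rep G c' c'' (local_rep F c c' y)) has_derivative
     (\<lambda>a. local_diff G c' c'' (F x) (local_diff F c c' x a))) (at (snd c x))" .
  then have "(local_rep (G \<circ> F) c c'' has_derivative
     (\<lambda>a. local_diff G c' c'' (F x) (local_diff F c c' x a))) (at (snd c x))"
  \<comment> \<open>The intermediate chart cancels only where \<open>F\<close> lands in its domain;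
    this set is open and contains the point.\<close>
  proof (rule has_derivative_transform_within_open)
    show "open (snd c ` (fst c \<inter> F -` fst c'))"
      by (rule open_local_rep_domain[OF F charts_atD(1)[OF c(1)] charts_atD(1)[OF c(2)]])
    show "snd c x \<in> snd c ` (fst c \<inter> F -` fst c')"
      using charts_atD(2)[OF c(1)] charts_atD(2)[OF c(2)] by auto
    show "local_rep G c' c'' (local_rep F c c' y) = local_rep (G \<circ> F) c c'' y"
      if "y \<in> snd c ` (fst c \<inter> F -` fst c')" for y
      using that by (auto simp: chart_inv_chart_at[OF c(1)] chart_inv_chart_at[OF c(2)])
  qed
  from fun_cong[OF frechet_derivative_at[OF this], of a] show ?thesis by (rule sym)
qed

text \<open>\<open>chart_inv c\<close> inverts the chart on its image only, so the representative of
  \<open>id\<close> agrees with the identity just near the point.\<close>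

lemma local_diff_id:
  assumes "c \<in> charts_at A x"
  shows "local_diff id c c x a = a"
proof -
  have "((\<lambda>y. y) has_derivative (\<lambda>a. a)) (at (snd c x))" by (rule has_derivative_ident)
  then have "(local_rep id c c has_derivative (\<lambda>a. a)) (at (snd c x))"
  proof (rule has_derivative_transform_within_open)
    show "open (snd c ` (fst c \<inter> UNIV))"
      by (rule open_chart_image[OF charts_atD(1)[OF assms] open_UNIV])
    show "snd c x \<in> snd c ` (fst c \<inter> UNIV)" using charts_atD(2)[OF assms] by auto
    show "y = local_rep id c c y" if "y \<in> snd c ` (fst c \<inter> UNIV)" for y
      using that by (auto simp: chart_inv_chart_at[OF assms])
  qed
  from fun_cong[OF frechet_derivative_at[OF this], of a] show ?thesis by (rule sym)
qed

section \<open>Tangent vectors determined by one chart\<close>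

lemma tangent_space_iff:
  "v \<in> tangent_space A x \<longleftrightarrow> (\<forall>c. c \<notin> charts_at A x \<longrightarrow> v c = 0) \<and>
     (\<forall>c\<in>charts_at A x. \<forall>c'\<in>charts_at A x. v c' = local_diff id c c' x (v c))"
  by (simp add: tangent_space_def)

text \<open>By the chain rule the change from \<open>c0\<close> to \<open>c'\<close> factors through
  any \<open>c\<close>; compatibility with \<open>c0\<close> alone therefore gives it for all
  pairs.\<close>

lemma tangentI:
  assumes c0: "c0 \<in> charts_at A x" and z: "\<And>c. c \<notin> charts_at A x \<Longrightarrow> v c = 0"
    and v: "\<And>c. c \<in> charts_at A x \<Longrightarrow> v c = local_diff id c0 c x (v c0)"
  shows "v \<in> tangent_space A x"
proof -
  have "v c' = local_diff id c c' x (v c)" if c: "c \<in> charts_at A x" "c' \<in> charts_at A x" for c c'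
    using local_diff_comp[OF smooth_map_id smooth_map_id c0, of c c' "v c0"] c
    by (simp add: v[OF c(1)] v[OF c(2)])
  then show ?thesis using z unfolding tangent_space_iff by blast
qed

lemma tangent_zero_outside: "v \<in> tangent_space A x \<Longrightarrow> c \<notin> charts_at A x \<Longrightarrow> v c = 0"
  unfolding tangent_space_iff by blast

lemma tangent_change_chart:
  "v \<in> tangent_space A x \<Longrightarrow> c \<in> charts_at A x \<Longrightarrow> c' \<in> charts_at A x \<Longrightarrow>
    local_diff id c c' x (v c) = v c'"
  unfolding tangent_space_iff by metis

lemma tangent_eqI:
  assumes "u \<in> tangent_space A x" "v \<in> tangent_space A x" "c \<in> charts_at A x" "u c = v c"
  shows "u = v"
proof
  fix c'
  show "u c' = v c'"
  proof (cases "c' \<in> charts_at A x")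
    case True
    then show ?thesis
      using tangent_change_chart[OF assms(1,3)] tangent_change_chart[OF assms(2,3)] assms(4) by metis
  next
    case False
    then show ?thesis using assms(1,2) tangent_zero_outside by metis
  qed
qed

lemma tvec_same: "c \<in> charts_at A x \<Longrightarrow> tvec A c x a c = a"
  using local_diff_id by (simp add: tvec_def)

lemma tvec_tangent:
  assumes c: "c \<in> charts_at A x"
  shows "tvec A c x a \<in> tangent_space A x"
  using tvec_same[OF c] by (intro tangentI[OF c]) (auto simp: tvec_def)

lemma tzero_tangent: "tzero \<in> tangent_space A x"
  using linear_0[OF linear_local_diff[OF smooth_map_id chart_at[of x]]]
  by (intro tangentI[OF chart_at]) (auto simp: tzero_def)

lemma tscale_tangent:
  assumes "v \<in> tangent_space A x" shows "tscale r v \<in> tangent_space A x"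
  using linear_cmul[OF linear_local_diff[OF smooth_map_id chart_at[of x]]]
    tangent_change_chart[OF assms chart_at] tangent_zero_outside[OF assms]
  by (intro tangentI[OF chart_at]) (auto simp: tscale_def)

lemma tadd_tangent:
  assumes "u \<in> tangent_space A x" "v \<in> tangent_space A x" shows "tadd u v \<in> tangent_space A x"
  using linear_add[OF linear_local_diff[OF smooth_map_id chart_at[of x]]]
    tangent_change_chart[OF assms(1) chart_at] tangent_change_chart[OF assms(2) chart_at]
    tangent_zero_outside[OF assms(1)] tangent_zero_outside[OF assms(2)]
  by (intro tangentI[OF chart_at]) (auto simp: tadd_def)

section \<open>The differential of a smooth map\<close>

lemma differential_apply:
  assumes F: "smooth_map A F" and u: "u \<in> tangent_space A x"
    and c: "c \<in> charts_at A x" "c' \<in> charts_at A (F x)"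
  shows "differential A F x u c' = local_diff F c c' x (u c)"
  \<comment> \<open>The definition evaluates \<open>u\<close> in the chosen chart
    \<open>chart_at A x\<close>; the chain rule for \<open>id\<close> followed by \<open>F\<close>
    and the compatibility of \<open>u\<close> allow an arbitrary chart instead.\<close>
  using local_diff_comp[OF smooth_map_id F c(1), of "chart_at A x" c' "u c"] c(2) chart_at[of x]
    tangent_change_chart[OF u c(1) chart_at]
  by (simp add: differential_def Let_def)

lemma differential_tangent:
  assumes F: "smooth_map A F" and u: "u \<in> tangent_space A x"
  shows "differential A F x u \<in> tangent_space A (F x)"
proof (rule tangentI[OF chart_at])
  fix c
  show "c \<notin> charts_at A (F x) \<Longrightarrow> differential A F x u c = 0" by (simp add: differential_def)
  assume c: "c \<in> charts_at A (F x)"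
  show "differential A F x u c
    = local_diff id (chart_at A (F x)) c (F x) (differential A F x u (chart_at A (F x)))"
    using local_diff_comp[OF F smooth_map_id chart_at chart_at, of c] c
    by (simp add: differential_apply[OF F u chart_at c] differential_apply[OF F u chart_at chart_at])
qed

lemma differential_eqI:
  assumes F: "smooth_map A F" and u: "u \<in> tangent_space A x" and w: "w \<in> tangent_space A (F x)"
    and c: "c \<in> charts_at A x" "c' \<in> charts_at A (F x)" and eq: "local_diff F c c' x (u c) = w c'"
  shows "differential A F x u = w"
  by (rule tangent_eqI[OF differential_tangent[OF F u] w c(2)])
    (simp add: differential_apply[OF F u c] eq)

lemma differential_tvec:
  assumes F: "smooth_map A F" and c: "c \<in> charts_at A x" "c' \<in> charts_at A (F x)"
  shows "differential A F x (tvec A c x a) = tvec A c' (F x) (local_diff F c c' x a)"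
  by (rule differential_eqI[OF F tvec_tangent[OF c(1)] tvec_tangent[OF c(2)] c])
    (simp only: tvec_same[OF c(1)] tvec_same[OF c(2)])

lemma differential_tzero:
  assumes F: "smooth_map A F"
  shows "differential A F x tzero = tzero"
  by (intro differential_eqI[OF F tzero_tangent tzero_tangent chart_at chart_at])
    (use linear_0[OF linear_local_diff[OF F chart_at chart_at]] in \<open>simp add: tzero_def\<close>)

lemma differential_tscale:
  assumes F: "smooth_map A F" and u: "u \<in> tangent_space A x"
  shows "differential A F x (tscale r u) = tscale r (differential A F x u)"
  by (intro differential_eqI[OF F tscale_tangent[OF u]
        tscale_tangent[OF differential_tangent[OF F u]] chart_at chart_at])
    (use linear_cmul[OF linear_local_diff[OF F chart_at chart_at]]
      differential_apply[OF F u chart_at chart_at] in \<open>simp add: tscale_def\<close>)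

text \<open>Smoothness of the composition is a separate hypothesis; in the uses below an isometry is
  composed with its inverse, giving \<open>id\<close>.\<close>

lemma differential_comp:
  assumes F: "smooth_map A F" and G: "smooth_map A G"
    and GF: "smooth_map A (G \<circ> F)" and u: "u \<in> tangent_space A x"
  shows "differential A (G \<circ> F) x u = differential A G (F x) (differential A F x u)"
proof -
  have w: "differential A G (F x) (differential A F x u) \<in> tangent_space A ((G \<circ> F) x)"
    using differential_tangent[OF G differential_tangent[OF F u]] by simp
  let ?c = "chart_at A x" and ?c' = "chart_at A (F x)" and ?c'' = "chart_at A ((G \<circ> F) x)"
  have c'': "?c'' \<in> charts_at A (G (F x))" using chart_at[of "(G \<circ> F) x"] by simp
  show ?thesis
    using local_diff_comp[OF F G chart_at chart_at c'', of "u ?c"]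
    by (intro differential_eqI[OF GF u w chart_at chart_at])
      (simp only: differential_apply[OF G differential_tangent[OF F u] chart_at c'']
        differential_apply[OF F u chart_at chart_at])
qed

lemma differential_id:
  assumes "u \<in> tangent_space A x"
  shows "differential A id x u = u"
proof (rule differential_eqI[OF smooth_map_id assms _ chart_at])
  show "u \<in> tangent_space A (id x)" "chart_at A x \<in> charts_at A (id x)"
    using assms chart_at by simp_all
  show "local_diff id (chart_at A x) (chart_at A x) x (u (chart_at A x)) = u (chart_at A x)"
    by (rule local_diff_id[OF chart_at])
qed

text \<open>The curve re-enters the representative through \<open>chart_inv c\<close>, which is
  legitimate only while it stays in the chart; continuity ensures this near \<open>t\<close>. The
  filter \<open>within J\<close> covers one-sided derivatives at the ends of curve pieces as well as
  geodesics.\<close>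

lemma has_vector_derivative_local_rep:
  assumes F: "smooth_map A F" and t: "t \<in> J" "continuous (at t within J) \<gamma>"
    and c: "c \<in> charts_at A (\<gamma> t)" "c' \<in> charts_at A (F (\<gamma> t))"
    and d: "((snd c \<circ> \<gamma>) has_vector_derivative d) (at t within J)"
  shows "((snd c' \<circ> (F \<circ> \<gamma>)) has_vector_derivative local_diff F c c' (\<gamma> t) d) (at t within J)"
proof -
  let ?L = "local_diff F c c' (\<gamma> t)"
  have "(local_rep F c c' has_derivative ?L) (at ((snd c \<circ> \<gamma>) t))"
    using has_derivative_local_rep[OF F c] by simp
  from has_derivative_compose[OF d[unfolded has_vector_derivative_def] this]
  have 1: "((\<lambda>s. local_rep F c c' ((snd c \<circ> \<gamma>) s)) has_derivative (\<lambda>s. ?L (s *\<^sub>R d))) (at t within J)" .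
  have "\<forall>\<^sub>F s in at t within J. \<gamma> s \<in> fst c"
    using t(2)[unfolded continuous_within] open_chart_domain[OF charts_atD(1)[OF c(1)]]
      charts_atD(2)[OF c(1)] by (rule topological_tendstoD)
  then have ev: "\<forall>\<^sub>F s in at t within J. local_rep F c c' ((snd c \<circ> \<gamma>) s) = (snd c' \<circ> (F \<circ> \<gamma>)) s"
    by eventually_elim (simp add: chart_inv_chart_at[OF c(1)])
  have "((snd c' \<circ> (F \<circ> \<gamma>)) has_derivative (\<lambda>s. ?L (s *\<^sub>R d))) (at t within J)"
    by (rule has_derivative_transform_eventually[OF 1 ev _ t(1)])
      (simp add: chart_inv_chart_at[OF c(1) charts_atD(2)[OF c(1)]])
  then show ?thesis
    by (simp only: has_vector_derivative_def linear_cmul[OF linear_local_diff[OF F c]])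
qed

text \<open>Differentiability in one chart gives it in all charts around the point, so
  \<open>vector_derivative\<close> is a true derivative in each of them and the velocity is a
  tangent vector.\<close>

lemma velocity_eq_tvec:
  assumes "isCont \<gamma> t" and c: "c \<in> charts_at A (\<gamma> t)"
    and d: "((snd c \<circ> \<gamma>) has_vector_derivative d) (at t)"
  shows "velocity A \<gamma> t = tvec A c (\<gamma> t) d"
proof
  fix c'
  show "velocity A \<gamma> t c' = tvec A c (\<gamma> t) d c'"
  proof (cases "c' \<in> charts_at A (\<gamma> t)")
    case True
    have "((snd c' \<circ> (id \<circ> \<gamma>)) has_vector_derivative local_diff id c c' (\<gamma> t) d) (at t)"
      using assms True by (intro has_vector_derivative_local_rep[OF smooth_map_id]) auto
    then show ?thesis using True vector_derivative_at by (simp add: velocity_def tvec_def)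
  qed (simp add: velocity_def tvec_def)
qed

lemma velocity_comp:
  assumes F: "smooth_map A F" and cont: "isCont \<gamma> t" and c: "c \<in> charts_at A (\<gamma> t)"
    and d: "((snd c \<circ> \<gamma>) has_vector_derivative d) (at t)"
  shows "velocity A (F \<circ> \<gamma>) t = differential A F (\<gamma> t) (velocity A \<gamma> t)"
proof -
  let ?c' = "chart_at A (F (\<gamma> t))"
  have "((snd ?c' \<circ> (F \<circ> \<gamma>)) has_vector_derivative local_diff F c ?c' (\<gamma> t) d) (at t)"
    using cont by (intro has_vector_derivative_local_rep[OF F _ _ c chart_at d]) auto
  moreover have "isCont (F \<circ> \<gamma>) t"
    using cont smooth_map_isCont[OF F] by (intro continuous_at_compose)
  ultimately have "velocity A (F \<circ> \<gamma>) t = tvec A ?c' ((F \<circ> \<gamma>) t) (local_diff F c ?c' (\<gamma> t) d)"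
    using chart_at[of "F (\<gamma> t)"] by (intro velocity_eq_tvec) auto
  then show ?thesis
    by (simp add: velocity_eq_tvec[OF cont c d] differential_tvec[OF F c chart_at])
qed

end


section \<open>The Koszul formula in coordinates\<close>

lemma vec_eq_sum_axis: "(a::real^'n) = (\<Sum>i\<in>UNIV. a $ i *\<^sub>R axis i 1)"
  using basis_expansion[of a] by (simp add: scalar_mult_eq_scaleR)

lemma linear_vec_sum_axis:
  assumes "linear L"
  shows "L (a::real^'n) = (\<Sum>i\<in>UNIV. a $ i *\<^sub>R L (axis i 1))"
  using assms by (subst vec_eq_sum_axis) (simp add: linear_sum linear_cmul del: basis_expansion)

text \<open>The metric as a point-dependent form on a fixed space: tangent spaces vary with the
  point, so \<open>g\<close> itself cannot be differentiated directly.\<close>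

definition gram_form ::
    "('m, 'n::finite) chart set \<Rightarrow> ('m, 'n) metric \<Rightarrow> ('m, 'n) chart \<Rightarrow> real ^ 'n \<Rightarrow>
     real ^ 'n \<Rightarrow> real ^ 'n \<Rightarrow> real" where
  "gram_form A g c y a b = (\<Sum>i\<in>UNIV. \<Sum>j\<in>UNIV. a $ i * b $ j * gram A g c y $ i $ j)"

text \<open>The derivative of \<open>gram_form\<close> in the base point along \<open>w\<close>,
  with \<open>a\<close> and \<open>b\<close> held constant.\<close>

definition gram_form_deriv ::
    "('m, 'n::finite) chart set \<Rightarrow> ('m, 'n) metric \<Rightarrow> ('m, 'n) chart \<Rightarrow> real ^ 'n \<Rightarrow>
     real ^ 'n \<Rightarrow> real ^ 'n \<Rightarrow> real ^ 'n \<Rightarrow> real" where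
  "gram_form_deriv A g c y w a b =
     (\<Sum>i\<in>UNIV. \<Sum>j\<in>UNIV. a $ i * b $ j * frechet_derivative (\<lambda>z. gram A g c z $ i $ j) (at y) w)"

lemma linear_gram_form_left: "linear (\<lambda>a. gram_form A g c y a b)"
  by (intro linearI) (simp_all add: gram_form_def sum.distrib sum_distrib_left algebra_simps)

lemma linear_gram_form_right: "linear (\<lambda>b. gram_form A g c y a b)"
  by (intro linearI) (simp_all add: gram_form_def sum.distrib sum_distrib_left algebra_simps)

lemma gram_form_inner: "gram_form A g c y a b = a \<bullet> (gram A g c y *v b)"
  by (simp add: gram_form_def inner_vec_def matrix_vector_mult_def sum_distrib_left mult_ac)

locale riemannian = smooth_manifold A
  for A :: "('m::t2_space, 'n::finite) chart set" +
  fixes g :: "('m, 'n) metric"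
  assumes metric: "riemannian_metric A g"
begin

section \<open>Coordinates and nondegeneracy of the metric\<close>

lemma metric_sym:
  "u \<in> tangent_space A x \<Longrightarrow> v \<in> tangent_space A x \<Longrightarrow> g x u v = g x v u"
  using metric unfolding riemannian_metric_def by blast

lemma metric_linear_left:
  "u \<in> tangent_space A x \<Longrightarrow> v \<in> tangent_space A x \<Longrightarrow> w \<in> tangent_space A x \<Longrightarrow>
   g x (tadd (tscale r u) (tscale s v)) w = r * g x u w + s * g x v w"
  using metric unfolding riemannian_metric_def by blast

lemma metric_pos:
  "u \<in> tangent_space A x \<Longrightarrow> u \<noteq> tzero \<Longrightarrow> 0 < g x u u"
  using metric unfolding riemannian_metric_def by blast

lemma gram_differentiable:
  "c \<in> A \<Longrightarrow> y \<in> snd c ` fst c \<Longrightarrow> (\<lambda>z. gram A g c z $ i $ j) differentiable (at y)"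
  using metric smooth_on_differentiable unfolding riemannian_metric_def by blast

lemma tvec_linear_combination:
  assumes c: "c \<in> charts_at A x"
  shows "tvec A c x (r *\<^sub>R a + s *\<^sub>R b) = tadd (tscale r (tvec A c x a)) (tscale s (tvec A c x b))"
  by (rule tangent_eqI[OF tvec_tangent[OF c] tadd_tangent[OF
        tscale_tangent[OF tvec_tangent[OF c]] tscale_tangent[OF tvec_tangent[OF c]]] c])
    (simp add: tadd_def tscale_def tvec_same[OF c])

lemma metric_tvec:
  assumes c: "c \<in> charts_at A x"
  shows "g x (tvec A c x a) (tvec A c x b) = gram_form A g c (snd c x) a b"
proof -
  let ?B = "\<lambda>a b. g x (tvec A c x a) (tvec A c x b)"
  have inv: "chart_inv c (snd c x) = x" by (rule chart_inv_chart_at[OF c charts_atD(2)[OF c]])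
  have comb: "?B (r *\<^sub>R a + s *\<^sub>R a') b = r * ?B a b + s * ?B a' b" for r s a a' b
    by (simp only: tvec_linear_combination[OF c]
        metric_linear_left[OF tvec_tangent[OF c] tvec_tangent[OF c] tvec_tangent[OF c]])
  have sym: "?B a b = ?B b a" for a b by (rule metric_sym[OF tvec_tangent[OF c] tvec_tangent[OF c]])
  have l: "linear (\<lambda>a. ?B a b)" for b
    using comb[of 1 _ 1] comb[of _ _ 0] by (intro linearI) auto
  \<comment> \<open>The metric axioms give linearity in the left slot only; symmetry supplies the
    right one.\<close>
  then have r: "linear (\<lambda>b. ?B a b)" for a unfolding sym[of a] .
  have "?B a b = (\<Sum>i\<in>UNIV. a $ i *\<^sub>R ?B (axis i 1) b)" by (rule linear_vec_sum_axis[OF l])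
  also have "\<dots> = (\<Sum>i\<in>UNIV. a $ i *\<^sub>R (\<Sum>j\<in>UNIV. b $ j *\<^sub>R ?B (axis i 1) (axis j 1)))"
    by (intro sum.cong refl arg_cong2[where f = scaleR] linear_vec_sum_axis[OF r])
  also have "\<dots> = gram_form A g c (snd c x) a b"
    by (simp add: gram_form_def gram_def inv sum_distrib_left mult.assoc)
  finally show ?thesis .
qed

context
  fixes c y
  assumes c: "c \<in> A" and y: "y \<in> snd c ` fst c"
begin

lemma chart_inv_in: "c \<in> charts_at A (chart_inv c y)" "snd c (chart_inv c y) = y"
  using c y chart_inv_chart[OF c] by (auto intro!: charts_atI)

lemma gram_form_eq_metric:
  "gram_form A g c y a b =
    g (chart_inv c y) (tvec A c (chart_inv c y) a) (tvec A c (chart_inv c y) b)"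
  using metric_tvec[OF chart_inv_in(1), of a b] chart_inv_in(2) by simp

lemma gram_form_sym: "gram_form A g c y a b = gram_form A g c y b a"
  unfolding gram_form_eq_metric
  by (rule metric_sym[OF tvec_tangent[OF chart_inv_in(1)] tvec_tangent[OF chart_inv_in(1)]])

lemma gram_form_nondegenerate:
  assumes "\<And>b. gram_form A g c y a b = 0" shows "a = 0"
proof (rule ccontr)
  assume "a \<noteq> 0"
  then have "tvec A c (chart_inv c y) a c \<noteq> tzero c"
    unfolding tvec_same[OF chart_inv_in(1)] by (simp add: tzero_def)
  then have "tvec A c (chart_inv c y) a \<noteq> tzero" by metis
  from metric_pos[OF tvec_tangent[OF chart_inv_in(1)] this] show False
    using assms[of a] by (simp add: gram_form_eq_metric)
qed

text \<open>\<open>matrix_inv\<close> is a choice, meaningful for invertible matrices only;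
  nondegeneracy gives a trivial kernel, hence invertibility.\<close>

lemma gram_mult_inv: "gram A g c y ** matrix_inv (gram A g c y) = mat 1"
proof -
  have "a = 0" if "gram A g c y *v a = 0" for a
  proof (rule gram_form_nondegenerate)
    fix b
    show "gram_form A g c y a b = 0" by (subst gram_form_sym) (simp add: gram_form_inner that)
  qed
  then have "invertible (gram A g c y)"
    using matrix_left_invertible_ker invertible_left_inverse by blast
  from someI_ex[OF this[unfolded invertible_def]] show ?thesis
    unfolding matrix_inv_def by blast
qed

lemma gram_partials:
  "frechet_derivative (\<lambda>z. gram A g c z $ i $ j) (at y) w
    = (\<Sum>l\<in>UNIV. w $ l * partial (\<lambda>z. gram A g c z $ i $ j) l y)"
  using linear_vec_sum_axis[OF linear_frechet_derivative[OF gram_differentiable[OF c y]], of i j w]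
  unfolding partial_def real_scaleR_def .

text \<open>For constant coordinate fields, whose brackets vanish, this is
  \<open>2 g(\<nabla>_a b, w) = a g(b, w) + b g(a, w) - w g(a, b)\<close>. Pairing with
  \<open>w\<close> removes the inverse Gram matrix, so the transformation law can be derived without
  handling matrix inverses.\<close>

lemma koszul:
  "2 * gram_form A g c y (christoffel A g c y a b) w
    = gram_form_deriv A g c y a b w + gram_form_deriv A g c y b a w - gram_form_deriv A g c y w a b"
proof -
  let ?G = "gram A g c y"
  let ?P = "\<lambda>i j l. partial (\<lambda>z. gram A g c z $ i $ j) l y"
  let ?T = "\<lambda>i j l. ?P j l i + ?P i l j - ?P i j l"
  \<comment> \<open>Twice the Christoffel symbols of the first kind, contracted with
    \<open>a\<close> and \<open>b\<close>.\<close>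
  define \<tau> where "\<tau> = (\<chi> l. \<Sum>i\<in>UNIV. \<Sum>j\<in>UNIV. ?T i j l * a $ i * b $ j)"
  have \<Gamma>: "2 *\<^sub>R christoffel A g c y a b = matrix_inv ?G *v \<tau>"
  proof (rule vec_eq_iff[THEN iffD2, rule_format])
    fix k
    have "(2 *\<^sub>R christoffel A g c y a b) $ k
      = (\<Sum>i\<in>UNIV. \<Sum>j\<in>UNIV. \<Sum>l\<in>UNIV. matrix_inv ?G $ k $ l * (?T i j l * a $ i * b $ j))"
      by (simp add: christoffel_def christoffel_symbol_def sum_distrib_left sum_distrib_right mult.assoc)
    also have "\<dots> = (\<Sum>i\<in>UNIV. \<Sum>l\<in>UNIV. \<Sum>j\<in>UNIV. matrix_inv ?G $ k $ l * (?T i j l * a $ i * b $ j))"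
      by (intro sum.cong refl sum.swap)
    also have "\<dots> = (\<Sum>l\<in>UNIV. \<Sum>i\<in>UNIV. \<Sum>j\<in>UNIV. matrix_inv ?G $ k $ l * (?T i j l * a $ i * b $ j))"
      by (rule sum.swap)
    also have "\<dots> = (matrix_inv ?G *v \<tau>) $ k"
      by (simp add: matrix_vector_mult_def \<tau>_def sum_distrib_left)
    finally show "(2 *\<^sub>R christoffel A g c y a b) $ k = (matrix_inv ?G *v \<tau>) $ k" .
  qed
  have "2 * gram_form A g c y (christoffel A g c y a b) w
    = gram_form A g c y (2 *\<^sub>R christoffel A g c y a b) w"
    by (simp only: linear_cmul[OF linear_gram_form_left] real_scaleR_def)
  also have "\<dots> = w \<bullet> (?G *v (matrix_inv ?G *v \<tau>))"
    \<comment> \<open>Symmetry moves the Christoffel vector into the second slot, where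
      \<open>?G\<close> meets its inverse.\<close>
    unfolding \<Gamma> by (subst gram_form_sym) (simp add: gram_form_inner)
  also have "\<dots> = w \<bullet> \<tau>" by (simp add: matrix_vector_mul_assoc gram_mult_inv)
  also have "\<dots> = (\<Sum>l\<in>UNIV. \<Sum>i\<in>UNIV. \<Sum>j\<in>UNIV. a $ i * b $ j * w $ l * ?P j l i)
      + (\<Sum>l\<in>UNIV. \<Sum>i\<in>UNIV. \<Sum>j\<in>UNIV. a $ i * b $ j * w $ l * ?P i l j)
      - (\<Sum>l\<in>UNIV. \<Sum>i\<in>UNIV. \<Sum>j\<in>UNIV. a $ i * b $ j * w $ l * ?P i j l)"
    by (simp add: inner_vec_def \<tau>_def sum_distrib_left algebra_simps sum.distrib sum_subtractf)
  also have "(\<Sum>l\<in>UNIV. \<Sum>i\<in>UNIV. \<Sum>j\<in>UNIV. a $ i * b $ j * w $ l * ?P j l i)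
    = gram_form_deriv A g c y a b w"
  proof -
    have "gram_form_deriv A g c y a b w
      = (\<Sum>j\<in>UNIV. \<Sum>l\<in>UNIV. \<Sum>i\<in>UNIV. a $ i * b $ j * w $ l * ?P j l i)"
      by (simp add: gram_form_deriv_def gram_partials sum_distrib_left mult_ac)
    also have "\<dots> = (\<Sum>l\<in>UNIV. \<Sum>j\<in>UNIV. \<Sum>i\<in>UNIV. a $ i * b $ j * w $ l * ?P j l i)"
      by (rule sum.swap)
    also have "\<dots> = (\<Sum>l\<in>UNIV. \<Sum>i\<in>UNIV. \<Sum>j\<in>UNIV. a $ i * b $ j * w $ l * ?P j l i)"
      by (intro sum.cong refl sum.swap)
    finally show ?thesis by simp
  qed
  also have "(\<Sum>l\<in>UNIV. \<Sum>i\<in>UNIV. \<Sum>j\<in>UNIV. a $ i * b $ j * w $ l * ?P i l j)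
    = gram_form_deriv A g c y b a w"
  proof -
    have "gram_form_deriv A g c y b a w
      = (\<Sum>i\<in>UNIV. \<Sum>l\<in>UNIV. \<Sum>j\<in>UNIV. a $ i * b $ j * w $ l * ?P i l j)"
      by (simp add: gram_form_deriv_def gram_partials sum_distrib_left mult_ac)
    also have "\<dots> = (\<Sum>l\<in>UNIV. \<Sum>i\<in>UNIV. \<Sum>j\<in>UNIV. a $ i * b $ j * w $ l * ?P i l j)"
      by (rule sum.swap)
    finally show ?thesis by simp
  qed
  also have "(\<Sum>l\<in>UNIV. \<Sum>i\<in>UNIV. \<Sum>j\<in>UNIV. a $ i * b $ j * w $ l * ?P i j l)
    = gram_form_deriv A g c y w a b"
  proof -
    have "(\<Sum>l\<in>UNIV. \<Sum>i\<in>UNIV. \<Sum>j\<in>UNIV. a $ i * b $ j * w $ l * ?P i j l)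
      = (\<Sum>i\<in>UNIV. \<Sum>l\<in>UNIV. \<Sum>j\<in>UNIV. a $ i * b $ j * w $ l * ?P i j l)"
      by (rule sum.swap)
    also have "\<dots> = (\<Sum>i\<in>UNIV. \<Sum>j\<in>UNIV. \<Sum>l\<in>UNIV. a $ i * b $ j * w $ l * ?P i j l)"
      by (intro sum.cong refl sum.swap)
    also have "\<dots> = gram_form_deriv A g c y w a b"
      by (simp add: gram_form_deriv_def gram_partials sum_distrib_left mult_ac)
    finally show ?thesis .
  qed
  finally show ?thesis .
qed

end

text \<open>A product rule with three moving parts. It serves once with only the base point moving,
  and once along a local representative whose derivative supplies the two arguments.\<close>

lemma has_derivative_gram_form:
  assumes c: "c \<in> A" and y: "\<phi> y \<in> snd c ` fst c"
    and X: "(X has_derivative X') (at y)" and Y: "(Y has_derivative Y') (at y)"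
    and \<phi>: "(\<phi> has_derivative \<phi>') (at y)"
  shows "((\<lambda>z. gram_form A g c (\<phi> z) (X z) (Y z)) has_derivative
    (\<lambda>w. gram_form_deriv A g c (\<phi> y) (\<phi>' w) (X y) (Y y)
      + gram_form A g c (\<phi> y) (X' w) (Y y) + gram_form A g c (\<phi> y) (X y) (Y' w))) (at y)"
proof -
  have comp: "((\<lambda>z. Z z $ i) has_derivative (\<lambda>w. Z' w $ i)) (at y)"
    if "(Z has_derivative Z') (at y)" for Z Z' :: "'a \<Rightarrow> real ^ 'n" and i
    using bounded_linear.has_derivative[OF bounded_linear_vec_nth that] .
  have G: "((\<lambda>z. gram A g c (\<phi> z) $ i $ j) has_derivative
      (\<lambda>w. frechet_derivative (\<lambda>z. gram A g c z $ i $ j) (at (\<phi> y)) (\<phi>' w))) (at y)" for i j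
    using has_derivative_compose[OF \<phi>
        gram_differentiable[OF c y, unfolded frechet_derivative_works]] .
  have "((\<lambda>z. X z $ i * Y z $ j * gram A g c (\<phi> z) $ i $ j) has_derivative
      (\<lambda>w. X y $ i * Y y $ j * frechet_derivative (\<lambda>z. gram A g c z $ i $ j) (at (\<phi> y)) (\<phi>' w)
        + (X y $ i * Y' w $ j + X' w $ i * Y y $ j) * gram A g c (\<phi> y) $ i $ j)) (at y)" for i j
    by (rule has_derivative_mult[OF has_derivative_mult[OF comp[OF X] comp[OF Y]] G])
  then have "((\<lambda>z. gram_form A g c (\<phi> z) (X z) (Y z)) has_derivative (\<lambda>w. \<Sum>i\<in>UNIV. \<Sum>j\<in>UNIV.
        X y $ i * Y y $ j * frechet_derivative (\<lambda>z. gram A g c z $ i $ j) (at (\<phi> y)) (\<phi>' w)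
        + (X y $ i * Y' w $ j + X' w $ i * Y y $ j) * gram A g c (\<phi> y) $ i $ j)) (at y)"
    unfolding gram_form_def by (intro has_derivative_sum)
  then show ?thesis
    by (rule has_derivative_eq_rhs)
      (simp add: fun_eq_iff gram_form_def gram_form_deriv_def distrib_right sum.distrib)
qed

end


section \<open>Isometries preserve geodesics\<close>

locale isometry = riemannian A g
  for A :: "('m::t2_space, 'n::finite) chart set" and g :: "('m, 'n) metric" +
  fixes F :: "'m \<Rightarrow> 'm"
  assumes isometry: "riemannian_isometry A g F"
begin

lemma bij: "bij F" and smooth: "smooth_map A F" and smooth_inv: "smooth_map A (inv F)"
  using isometry unfolding riemannian_isometry_def by blast+

lemma inv_left: "inv F (F x) = x" and inv_right: "F (inv F y) = y"
  using bij by (simp_all add: bij_is_inj bij_is_surj surj_f_inv_f)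

lemma comp_inv_left: "inv F \<circ> F = id" and comp_inv_right: "F \<circ> inv F = id"
  by (simp_all add: fun_eq_iff inv_left inv_right)

lemma metric_differential:
  "u \<in> tangent_space A x \<Longrightarrow> v \<in> tangent_space A x \<Longrightarrow>
    g (F x) (differential A F x u) (differential A F x v) = g x u v"
  using isometry unfolding riemannian_isometry_def by blast

lemma tnorm_differential:
  "u \<in> tangent_space A x \<Longrightarrow> tnorm g (F x) (differential A F x u) = tnorm g x u"
  by (simp add: tnorm_def metric_differential)

lemma differential_inv_left:
  assumes "u \<in> tangent_space A x"
  shows "differential A (inv F) (F x) (differential A F x u) = u"
  using differential_comp[OF smooth smooth_inv _ assms] smooth_map_id
  by (simp add: comp_inv_left differential_id[OF assms])

lemma differential_inv_right:
  assumes "u \<in> tangent_space A y"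
  shows "differential A F (inv F y) (differential A (inv F) y u) = u"
  using differential_comp[OF smooth_inv smooth _ assms] smooth_map_id
  by (simp add: comp_inv_right differential_id[OF assms])

text \<open>All results of the locale become available for \<open>inv F\<close>, which supplies the
  reverse direction whenever objects are transported.\<close>

lemma isometry_inv: "isometry A g (inv F)"
proof (intro isometry.intro isometry_axioms.intro riemannian_axioms)
  have "g (inv F y) (differential A (inv F) y u) (differential A (inv F) y v) = g y u v"
    if "u \<in> tangent_space A y" "v \<in> tangent_space A y" for y u v
    using metric_differential[OF differential_tangent[OF smooth_inv that(1)]
        differential_tangent[OF smooth_inv that(2)]]
    by (simp add: differential_inv_right that inv_right)
  then show "riemannian_isometry A g (inv F)"
    unfolding riemannian_isometry_def
    using bij smooth smooth_inv by (simp add: bij_imp_bij_inv inv_inv_eq)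
qed

section \<open>First and second derivatives of the local representative\<close>

context
  fixes c c' x
  assumes c: "c \<in> charts_at A x" and c': "c' \<in> charts_at A (F x)"
begin

private abbreviation (input) "\<Phi> \<equiv> local_rep F c c'"
private abbreviation (input) "L \<equiv> local_diff F c c' x"
private abbreviation (input) "form \<equiv> gram_form A g c' (snd c' (F x))"
private abbreviation (input) "D2 a b \<equiv>
  frechet_derivative (\<lambda>z. frechet_derivative (local_rep F c c') (at z) a) (at (snd c x)) b"

text \<open>Differentiating \<open>F \<circ> inv F = id\<close> in charts provides a right inverse
  of \<open>L\<close>.\<close>

lemma surj_local_diff: "\<exists>a. L a = b"
proof -
  have "local_diff (F \<circ> inv F) c' c' (F x) b
    = local_diff F c c' (inv F (F x)) (local_diff (inv F) c' c (F x) b)"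
    by (rule local_diff_comp[OF smooth_inv smooth c']) (simp_all add: inv_left c c')
  then have "L (local_diff (inv F) c' c (F x) b) = b"
    by (simp only: comp_inv_right local_diff_id[OF c'] inv_left)
  then show ?thesis ..
qed

lemma gram_form_pullback: "gram_form A g c (snd c x) a b = form (L a) (L b)"
  by (simp only: metric_tvec[OF c, symmetric] metric_tvec[OF c', symmetric]
      differential_tvec[OF smooth c c', symmetric]
      metric_differential[OF tvec_tangent[OF c] tvec_tangent[OF c]])

lemma local_rep_at: "local_rep F c c' (snd c x) = snd c' (F x)"
  by (simp add: chart_inv_chart_at[OF c charts_atD(2)[OF c]])

lemma local_rep_domain:
  "open (snd c ` (fst c \<inter> F -` fst c'))" "snd c x \<in> snd c ` (fst c \<inter> F -` fst c')"
  using open_local_rep_domain[OF smooth charts_atD(1)[OF c] charts_atD(1)[OF c']]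
    charts_atD(2)[OF c] charts_atD(2)[OF c'] by auto

lemma smooth_on_local_rep_chart: "smooth_on (snd c ` (fst c \<inter> F -` fst c')) \<Phi>"
  by (rule smooth_on_local_rep[OF smooth charts_atD(1)[OF c] charts_atD(1)[OF c']])

lemma has_derivative_local_diff:
  "((\<lambda>z. frechet_derivative \<Phi> (at z) a) has_derivative D2 a) (at (snd c x))"
  by (rule smooth_on_has_derivative[OF smooth_on_frechet_derivative[OF smooth_on_local_rep_chart]
        local_rep_domain(2)])

lemma second_derivative_local_rep_sym: "D2 a b = D2 b a"
  by (rule second_derivative_symmetric[OF smooth_on_local_rep_chart local_rep_domain])

end

text \<open>Two expressions for the derivative of one function: directly, and through the pullback
  identity, which holds on a whole neighbourhood. The \<open>D2\<close> terms arise because the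
  derivative of the representative depends on the point.\<close>

lemma gram_form_deriv_pullback:
  assumes c: "c \<in> charts_at A x" and c': "c' \<in> charts_at A (F x)"
  defines "D2 \<equiv> \<lambda>a. frechet_derivative (\<lambda>z. frechet_derivative (local_rep F c c') (at z) a) (at (snd c x))"
    and "L \<equiv> local_diff F c c' x"
  shows "gram_form_deriv A g c (snd c x) w a b
    = gram_form_deriv A g c' (snd c' (F x)) (L w) (L a) (L b)
      + gram_form A g c' (snd c' (F x)) (D2 a w) (L b)
      + gram_form A g c' (snd c' (F x)) (L a) (D2 b w)"
proof -
  let ?y = "snd c x" and ?\<Phi> = "local_rep F c c'"
  let ?D = "\<lambda>z. frechet_derivative ?\<Phi> (at z)"
  have y: "?y \<in> snd c ` fst c" using charts_atD(2)[OF c] by auto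
  have y': "?\<Phi> ?y \<in> snd c' ` fst c'"
    using charts_atD(2)[OF c'] by (simp only: local_rep_at[OF c c'] imageI)
  have "((\<lambda>z. gram_form A g c z a b) has_derivative
      (\<lambda>w. gram_form_deriv A g c ?y w a b + gram_form A g c ?y 0 b + gram_form A g c ?y a 0)) (at ?y)"
    by (rule has_derivative_gram_form[where \<phi> = "\<lambda>z. z" and X = "\<lambda>_. a" and Y = "\<lambda>_. b",
          OF charts_atD(1)[OF c] y]) (auto intro: derivative_eq_intros)
  then have 1: "((\<lambda>z. gram_form A g c z a b) has_derivative (\<lambda>w. gram_form_deriv A g c ?y w a b)) (at ?y)"
    by (simp only: linear_0[OF linear_gram_form_left] linear_0[OF linear_gram_form_right] add_0_right)
  have "((\<lambda>z. gram_form A g c' (?\<Phi> z) (?D z a) (?D z b)) has_derivative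
    (\<lambda>w. gram_form_deriv A g c' (?\<Phi> ?y) (?D ?y w) (?D ?y a) (?D ?y b)
      + gram_form A g c' (?\<Phi> ?y) (D2 a w) (?D ?y b)
      + gram_form A g c' (?\<Phi> ?y) (?D ?y a) (D2 b w))) (at ?y)"
    unfolding D2_def
    by (rule has_derivative_gram_form[OF charts_atD(1)[OF c'] y' has_derivative_local_diff[OF c c']
          has_derivative_local_diff[OF c c'] has_derivative_local_rep[OF smooth c c']])
  then have "((\<lambda>z. gram_form A g c z a b) has_derivative
    (\<lambda>w. gram_form_deriv A g c' (?\<Phi> ?y) (?D ?y w) (?D ?y a) (?D ?y b)
      + gram_form A g c' (?\<Phi> ?y) (D2 a w) (?D ?y b)
      + gram_form A g c' (?\<Phi> ?y) (?D ?y a) (D2 b w))) (at ?y)"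
  proof (rule has_derivative_transform_within_open[OF _ local_rep_domain[OF c c']])
    fix z assume "z \<in> snd c ` (fst c \<inter> F -` fst c')"
    then obtain x' where x': "z = snd c x'" "x' \<in> fst c" "F x' \<in> fst c'" by auto
    have cs: "c \<in> charts_at A x'" "c' \<in> charts_at A (F x')"
      using x' charts_atI charts_atD(1)[OF c] charts_atD(1)[OF c'] by blast+
    show "gram_form A g c' (?\<Phi> z) (?D z a) (?D z b) = gram_form A g c z a b"
      unfolding x'(1) gram_form_pullback[OF cs] local_rep_at[OF cs] ..
  qed
  from fun_cong[OF has_derivative_unique[OF 1 this], of w] show ?thesis
    unfolding L_def local_rep_at[OF c c'] .
qed

text \<open>The Koszul formulas in the two charts determine both sides tested against
  \<open>L w\<close>; as \<open>L\<close> is onto and the metric nondegenerate, the vectors agree.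
  The \<open>D2\<close> term reflects that Christoffel symbols are not tensorial.\<close>

lemma christoffel_pushforward:
  assumes c: "c \<in> charts_at A x" and c': "c' \<in> charts_at A (F x)"
  defines "D2 \<equiv> \<lambda>a. frechet_derivative (\<lambda>z. frechet_derivative (local_rep F c c') (at z) a) (at (snd c x))"
    and "L \<equiv> local_diff F c c' x"
  shows "L (christoffel A g c (snd c x) a b)
    = christoffel A g c' (snd c' (F x)) (L a) (L b) + D2 a b"
proof -
  let ?f = "gram_form A g c' (snd c' (F x))"
  let ?\<Gamma> = "christoffel A g c (snd c x) a b"
  let ?\<Gamma>' = "christoffel A g c' (snd c' (F x)) (L a) (L b)"
  have y: "snd c x \<in> snd c ` fst c" "snd c' (F x) \<in> snd c' ` fst c'"
    using charts_atD(2)[OF c] charts_atD(2)[OF c'] by auto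
  note A = charts_atD(1)[OF c] charts_atD(1)[OF c']
  have D2: "D2 u v = D2 v u" for u v unfolding D2_def by (rule second_derivative_local_rep_sym[OF c c'])
  have pull: "gram_form_deriv A g c (snd c x) u v w
    = gram_form_deriv A g c' (snd c' (F x)) (L u) (L v) (L w) + ?f (D2 v u) (L w) + ?f (L v) (D2 w u)"
    for u v w unfolding D2_def L_def by (rule gram_form_deriv_pullback[OF c c'])
  have "?f (L ?\<Gamma> - (?\<Gamma>' + D2 a b)) v = 0" for v
  proof -
    obtain w where w: "v = L w" using surj_local_diff[OF c c', of v] unfolding L_def by blast
    have "2 * ?f (L ?\<Gamma>) (L w) = 2 * gram_form A g c (snd c x) ?\<Gamma> w"
      unfolding L_def gram_form_pullback[OF c c'] ..
    \<comment> \<open>The three derivative terms contribute six \<open>D2\<close> terms. By symmetry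
      of \<open>D2\<close> and of the form, four cancel in pairs and the other two add up to the
      last summand.\<close>
    also have "\<dots> = 2 * ?f ?\<Gamma>' (L w) + 2 * ?f (D2 a b) (L w)"
      unfolding koszul[OF A(1) y(1)] pull koszul[OF A(2) y(2)]
      using D2[of a b] D2[of a w] D2[of b w] gram_form_sym[OF A(2) y(2), of "L b"]
        gram_form_sym[OF A(2) y(2), of "L a"] by simp
    finally have "?f (L ?\<Gamma>) (L w) = ?f ?\<Gamma>' (L w) + ?f (D2 a b) (L w)" by simp
    then show ?thesis
      unfolding w by (simp only: linear_diff[OF linear_gram_form_left]
          linear_add[OF linear_gram_form_left] diff_self)
  qed
  from gram_form_nondegenerate[OF A(2) y(2) this] show ?thesis by simp
qed

section \<open>The geodesic equation for image curves\<close>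

lemma geodesic_has_derivative:
  assumes "geodesic A g \<gamma>" "c \<in> charts_at A (\<gamma> t)"
  shows "\<exists>d. ((snd c \<circ> \<gamma>) has_vector_derivative d) (at t)"
  using assms charts_atD[OF assms(2)] unfolding geodesic_def by blast

lemma geodesic_isCont: "geodesic A g \<gamma> \<Longrightarrow> isCont \<gamma> t"
  by (simp add: geodesic_def continuous_on_eq_continuous_at)

text \<open>Differentiating the image curve twice gives \<open>D2\<close> of the velocity with
  itself plus the image of the acceleration; the former cancels against the inhomogeneous term of
  the Christoffel law.\<close>

lemma geodesic_comp:
  assumes geo: "geodesic A g \<gamma>"
  shows "geodesic A g (F \<circ> \<gamma>)"
  unfolding geodesic_def
proof (intro conjI ballI)
  have cont: "isCont \<gamma> t" for t by (rule geodesic_isCont[OF geo])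
  show "continuous_on UNIV (F \<circ> \<gamma>)"
    using geo smooth unfolding geodesic_def smooth_map_def o_def
    by (blast intro: continuous_on_compose2[of UNIV F])
  fix c' assume "c' \<in> A"
  \<comment> \<open>\<open>geodesic\<close> asks for one \<open>x'\<close> per target chart, valid
    for all times, whereas the source chart below varies with the time; the canonical derivative
    avoids gluing.\<close>
  define x' where "x' = (\<lambda>t. vector_derivative (snd c' \<circ> (F \<circ> \<gamma>)) (at t))"
  have "((snd c' \<circ> (F \<circ> \<gamma>)) has_vector_derivative x' t) (at t) \<and>
    (x' has_vector_derivative - christoffel A g c' (snd c' ((F \<circ> \<gamma>) t)) (x' t) (x' t)) (at t)"
    if t: "(F \<circ> \<gamma>) t \<in> fst c'" for t
  proof -
    define c where "c = chart_at A (\<gamma> t)"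
    have c: "c \<in> charts_at A (\<gamma> t)" unfolding c_def by (rule chart_at)
    have c': "c' \<in> charts_at A (F (\<gamma> t))" using t \<open>c' \<in> A\<close> by (simp add: charts_atI)
    obtain X where X: "\<And>s. \<gamma> s \<in> fst c \<Longrightarrow> ((snd c \<circ> \<gamma>) has_vector_derivative X s) (at s)"
      "\<And>s. \<gamma> s \<in> fst c \<Longrightarrow>
        (X has_vector_derivative - christoffel A g c (snd c (\<gamma> s)) (X s) (X s)) (at s)"
      using geo charts_atD(1)[OF c] unfolding geodesic_def by blast
    \<comment> \<open>An open set of times at which both charts apply, so the formula for
      \<open>x'\<close> holds near \<open>t\<close> and can be differentiated.\<close>
    define U where "U = \<gamma> -` (fst c \<inter> F -` fst c')"
    have "open (fst c \<inter> F -` fst c')"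
      using smooth open_chart_domain[OF charts_atD(1)[OF c]] open_chart_domain[OF \<open>c' \<in> A\<close>]
      by (intro open_Int open_vimage) (auto simp: smooth_map_def)
    then have "open U"
      using geo unfolding U_def geodesic_def by (blast intro: open_vimage)
    moreover have "t \<in> U"
      unfolding U_def using charts_atD(2)[OF c] charts_atD(2)[OF c'] by simp
    ultimately have U: "open U" "t \<in> U" .
    define D where "D = (\<lambda>z. frechet_derivative (local_rep F c c') (at z))"
    define D2 where "D2 = (\<lambda>a. frechet_derivative (\<lambda>z. D z a) (at (snd c (\<gamma> t))))"
    have cs: "c \<in> charts_at A (\<gamma> s)" "c' \<in> charts_at A (F (\<gamma> s))" if "s \<in> U" for s
      using that charts_atI charts_atD(1)[OF c] \<open>c' \<in> A\<close> unfolding U_def by blast+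
    have vd: "((snd c' \<circ> (F \<circ> \<gamma>)) has_vector_derivative D (snd c (\<gamma> s)) (X s)) (at s)"
      if "s \<in> U" for s
      unfolding D_def
      by (rule has_vector_derivative_local_rep[OF smooth _ cont cs[OF that]
            X(1)[OF charts_atD(2)[OF cs(1)[OF that]]]]) simp
    then have x': "x' s = D (snd c (\<gamma> s)) (X s)" if "s \<in> U" for s
      using that vector_derivative_at unfolding x'_def by blast
    have lin: "linear (D (snd c (\<gamma> s)))" if "s \<in> U" for s
      unfolding D_def by (rule linear_local_diff[OF smooth cs[OF that]])
    have D2_lin: "linear (D2 a)" for a
      unfolding D2_def D_def by (rule has_derivative_linear[OF has_derivative_local_diff[OF c c']])
    define X' where "X' = - christoffel A g c (snd c (\<gamma> t)) (X t) (X t)"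
    have XX: "(X has_vector_derivative X') (at t)"
      unfolding X'_def by (rule X(2)[OF charts_atD(2)[OF c]])
    \<comment> \<open>Smoothness differentiates \<open>D z e\<close> for a fixed vector
      \<open>e\<close> only, so the moving argument \<open>X s\<close> is expanded in the
      basis.\<close>
    have summand: "((\<lambda>s. X s $ i *\<^sub>R D (snd c (\<gamma> s)) (axis i 1)) has_vector_derivative
        (X t $ i *\<^sub>R D2 (axis i 1) (X t) + X' $ i *\<^sub>R D (snd c (\<gamma> t)) (axis i 1))) (at t)" for i
    proof (rule has_vector_derivative_scaleR)
      show "((\<lambda>s. X s $ i) has_real_derivative X' $ i) (at t)"
        unfolding has_real_derivative_iff_has_vector_derivative
        by (rule bounded_linear.has_vector_derivative[OF bounded_linear_vec_nth XX])
      have "((\<lambda>z. D z (axis i 1)) has_derivative D2 (axis i 1)) (at ((snd c \<circ> \<gamma>) t))"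
        unfolding D2_def D_def using has_derivative_local_diff[OF c c'] by simp
      from vector_derivative_diff_chain_within[OF X(1)[OF charts_atD(2)[OF c]]
          has_derivative_at_withinI[OF this]]
      show "((\<lambda>s. D (snd c (\<gamma> s)) (axis i 1)) has_vector_derivative D2 (axis i 1) (X t)) (at t)"
        by (simp add: o_def)
    qed
    have "((\<lambda>s. \<Sum>i\<in>UNIV. X s $ i *\<^sub>R D (snd c (\<gamma> s)) (axis i 1)) has_vector_derivative
        (\<Sum>i\<in>UNIV. X t $ i *\<^sub>R D2 (axis i 1) (X t) + X' $ i *\<^sub>R D (snd c (\<gamma> t)) (axis i 1))) (at t)"
      by (intro has_vector_derivative_sum summand)
    then have "(x' has_vector_derivative
        (\<Sum>i\<in>UNIV. X t $ i *\<^sub>R D2 (axis i 1) (X t) + X' $ i *\<^sub>R D (snd c (\<gamma> t)) (axis i 1))) (at t)"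
    proof (rule has_vector_derivative_transform_within_open[OF _ U])
      fix s assume s: "s \<in> U"
      show "(\<Sum>i\<in>UNIV. X s $ i *\<^sub>R D (snd c (\<gamma> s)) (axis i 1)) = x' s"
        unfolding x'[OF s] by (rule linear_vec_sum_axis[OF lin[OF s], symmetric])
    qed
    \<comment> \<open>The swap puts the basis vector into the second slot of \<open>D2\<close>,
      where linearity is immediate because that slot is the argument of a derivative.\<close>
    also have "(\<Sum>i\<in>UNIV. X t $ i *\<^sub>R D2 (axis i 1) (X t) + X' $ i *\<^sub>R D (snd c (\<gamma> t)) (axis i 1))
      = (\<Sum>i\<in>UNIV. X t $ i *\<^sub>R D2 (X t) (axis i 1)) + (\<Sum>i\<in>UNIV. X' $ i *\<^sub>R D (snd c (\<gamma> t)) (axis i 1))"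
      unfolding D2_def D_def by (simp only: sum.distrib second_derivative_local_rep_sym[OF c c', of "X t"])
    also have "\<dots> = D2 (X t) (X t) + D (snd c (\<gamma> t)) X'"
      by (simp only: linear_vec_sum_axis[OF D2_lin, of _ "X t"] linear_vec_sum_axis[OF lin[OF U(2)], of X'])
    also have "\<dots> = - christoffel A g c' (snd c' (F (\<gamma> t))) (D (snd c (\<gamma> t)) (X t)) (D (snd c (\<gamma> t)) (X t))"
      using christoffel_pushforward[OF c c', of "X t" "X t"] linear_neg[OF lin[OF U(2)]]
      unfolding X'_def D2_def D_def by simp
    finally have "(x' has_vector_derivative - christoffel A g c' (snd c' ((F \<circ> \<gamma>) t)) (x' t) (x' t)) (at t)"
      by (simp add: x'[OF U(2)])
    then show ?thesis using vd[OF U(2)] x'[OF U(2)] by simp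
  qed
  then show "\<exists>x'. \<forall>t. (F \<circ> \<gamma>) t \<in> fst c' \<longrightarrow>
      ((snd c' \<circ> (F \<circ> \<gamma>)) has_vector_derivative x' t) (at t) \<and>
      (x' has_vector_derivative - christoffel A g c' (snd c' ((F \<circ> \<gamma>) t)) (x' t) (x' t)) (at t)"
    by blast
qed

end


section \<open>Isometries preserve lengths of curves\<close>

context isometry
begin

lemma C1_curve_comp:
  assumes curve: "C1_curve_on A {a..b} \<gamma>" and cont: "continuous_on {a..b} \<gamma>"
  shows "C1_curve_on A {a..b} (F \<circ> \<gamma>)"
proof (cases "a < b")
  \<comment> \<open>a division may contain one-point intervals, where the derivative is not unique\<close>
  case False
  then have J: "t = a" "{a..b} = {a}" if "t \<in> {a..b}" for t using that by auto
  have "continuous_on ({a..b} \<inter> S) h" for S and h :: "real \<Rightarrow> real ^ 'n"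
    by (rule continuous_on_subset[OF continuous_on_sing[of a]]) (use J in auto)
  moreover have "(h has_vector_derivative 0) (at t within {a..b})" if "t \<in> {a..b}"
    for t and h :: "real \<Rightarrow> real ^ 'n"
    unfolding has_vector_derivative_def J(2)[OF that]
    by (simp add: J(1)[OF that] has_derivative_within_singleton_iff)
  ultimately show ?thesis
    unfolding C1_curve_on_def by (intro ballI exI[of _ "\<lambda>_. 0"] conjI) auto
next
  case True
  let ?J = "{a..b}"
  show ?thesis
    unfolding C1_curve_on_def
  proof (intro ballI exI conjI)
    fix c' assume "c' \<in> A"
    let ?W = "?J \<inter> (F \<circ> \<gamma>) -` fst c'"
    \<comment> \<open>On a nondegenerate interval the derivative within \<open>?J\<close> is unique,
      so \<open>x'\<close> does not depend on the source charts used to compute it locally.\<close>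
    define x' where "x' = (\<lambda>t. vector_derivative (snd c' \<circ> (F \<circ> \<gamma>)) (at t within ?J))"
    have main: "((snd c' \<circ> (F \<circ> \<gamma>)) has_vector_derivative x' t) (at t within ?J) \<and>
      continuous (at t within ?W) x'" if t: "t \<in> ?W" for t
    proof -
      define c where "c = chart_at A (\<gamma> t)"
      have c: "c \<in> charts_at A (\<gamma> t)" unfolding c_def by (rule chart_at)
      obtain X where X: "continuous_on (?J \<inter> \<gamma> -` fst c) X"
        "\<And>s. s \<in> ?J \<inter> \<gamma> -` fst c \<Longrightarrow> ((snd c \<circ> \<gamma>) has_vector_derivative X s) (at s within ?J)"
        using curve charts_atD(1)[OF c] unfolding C1_curve_on_def by blast
      define V where "V = ?W \<inter> \<gamma> -` fst c"
      define D where "D = (\<lambda>z. frechet_derivative (local_rep F c c') (at z))"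
      have tV: "t \<in> V" using t charts_atD(2)[OF c] by (simp add: V_def)
      have cs: "c \<in> charts_at A (\<gamma> s)" "c' \<in> charts_at A (F (\<gamma> s))" if "s \<in> V" for s
        using that charts_atI charts_atD(1)[OF c] \<open>c' \<in> A\<close> unfolding V_def by auto
      have vd: "((snd c' \<circ> (F \<circ> \<gamma>)) has_vector_derivative D (snd c (\<gamma> s)) (X s)) (at s within ?J)"
        if s: "s \<in> V" for s
        unfolding D_def
        by (rule has_vector_derivative_local_rep[OF smooth _ _ cs[OF s] X(2)])
          (use s cont in \<open>auto simp: V_def continuous_on_eq_continuous_within\<close>)
      have x': "x' s = D (snd c (\<gamma> s)) (X s)" if s: "s \<in> V" for s
        unfolding x'_def
        by (rule vector_derivative_within_closed_interval[OF True _ vd[OF s]])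
          (use s in \<open>simp add: V_def\<close>)
      have lin: "linear (D (snd c (\<gamma> s)))" if "s \<in> V" for s
        unfolding D_def by (rule linear_local_diff[OF smooth cs[OF that]])
      have sub: "V \<subseteq> ?J \<inter> \<gamma> -` fst c" by (auto simp: V_def)
      have contD: "continuous_on (snd c ` (fst c \<inter> F -` fst c')) (\<lambda>z. D z e)" for e
        unfolding D_def
        by (intro smooth_on_continuous_on smooth_on_frechet_derivative
            smooth_on_local_rep[OF smooth charts_atD(1)[OF c] \<open>c' \<in> A\<close>])
      have "continuous_on (fst c) (snd c)"
        using is_chart[OF charts_atD(1)[OF c]] unfolding is_chart_def homeomorphism_def by blast
      then have "continuous_on V (\<lambda>s. snd c (\<gamma> s))"
        by (rule continuous_on_compose2[OF _ continuous_on_subset[OF cont]]) (auto simp: V_def)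
      then have contDs: "continuous_on V (\<lambda>s. D (snd c (\<gamma> s)) e)" for e
        by (rule continuous_on_compose2[OF contD]) (auto simp: V_def)
      have "continuous_on V (\<lambda>s. \<Sum>i\<in>UNIV. X s $ i *\<^sub>R D (snd c (\<gamma> s)) (axis i 1))"
        by (intro continuous_intros contDs continuous_on_subset[OF X(1) sub])
      then have "continuous_on V x'"
        by (rule continuous_on_eq) (simp only: x' linear_vec_sum_axis[OF lin, symmetric])
      then have "continuous (at t within V) x'" using tV by (simp add: continuous_on_eq_continuous_within)
      moreover obtain T where T: "open T" "T \<inter> ?J = \<gamma> -` fst c \<inter> ?J"
        using cont open_chart_domain[OF charts_atD(1)[OF c]] unfolding continuous_on_open_invariant by blast
      \<comment> \<open>\<open>V\<close> is relatively open in \<open>?W\<close>, so continuity at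
        \<open>t\<close> within the one is continuity within the other.\<close>
      have "at t within V = at t within ?W"
        by (rule at_within_nhd[of t T]) (use T tV in \<open>auto simp: V_def\<close>)
      ultimately show ?thesis using vd[OF tV] x'[OF tV] by simp
    qed
    then show "continuous_on ?W x'" by (simp add: continuous_on_eq_continuous_within)
    show "((snd c' \<circ> (F \<circ> \<gamma>)) has_vector_derivative x' t) (at t within ?J)" if "t \<in> ?W" for t
      using main[OF that] by blast
  qed
qed

lemma piecewise_C1_curve_comp:
  assumes "piecewise_C1_curve A \<gamma>"
  shows "piecewise_C1_curve A (F \<circ> \<gamma>)"
proof -
  obtain D where cont: "continuous_on {0..1} \<gamma>" and D: "D division_of {0..1}"
      "\<And>J. J \<in> D \<Longrightarrow> C1_curve_on A J \<gamma>"
    using assms unfolding piecewise_C1_curve_def by blast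
  have "C1_curve_on A J (F \<circ> \<gamma>)" if J: "J \<in> D" for J
  proof -
    obtain a b where "J = {a..b}" using division_ofD(4)[OF D(1) J] by auto
    then show ?thesis
      using C1_curve_comp D(2)[OF J] continuous_on_subset[OF cont division_ofD(2)[OF D(1) J]] by simp
  qed
  moreover have "continuous_on {0..1} (F \<circ> \<gamma>)"
    using cont smooth unfolding smooth_map_def
    by (intro continuous_on_compose) (auto intro: continuous_on_subset)
  ultimately show ?thesis using D(1) unfolding piecewise_C1_curve_def by blast
qed

text \<open>The differential preserves norms, so the integrands agree wherever the velocity exists.
  As \<open>velocity\<close> is a two-sided derivative, it may fail at the ends of the pieces, which
  form a finite and hence negligible set.\<close>

lemma curve_length_comp:
  assumes "piecewise_C1_curve A \<gamma>"
  shows "curve_length A g (F \<circ> \<gamma>) = curve_length A g \<gamma>"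
proof -
  obtain D where cont: "continuous_on {0..1} \<gamma>" and D: "D division_of {0..1}"
      "\<And>J. J \<in> D \<Longrightarrow> C1_curve_on A J \<gamma>"
    using assms unfolding piecewise_C1_curve_def by blast
  define N where "N = (\<Union>J\<in>D. {Inf J, Sup J})"
  have "finite N" unfolding N_def using division_ofD(1)[OF D(1)] by auto
  have eq: "tnorm g (\<gamma> t) (velocity A \<gamma> t)
      = tnorm g ((F \<circ> \<gamma>) t) (velocity A (F \<circ> \<gamma>) t)" if t: "t \<in> {0..1} - N" for t
  proof -
    have "t \<in> \<Union>D" using t division_ofD(6)[OF D(1)] by simp
    then obtain J where J: "J \<in> D" "t \<in> J" by blast
    obtain a b where ab: "J = {a..b}" using division_ofD(4)[OF D(1) J(1)] by auto
    have "a \<le> b" using J ab by auto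
    then have "Inf J = a" "Sup J = b" unfolding ab by simp_all
    then have "a \<in> N" "b \<in> N" using J(1) unfolding N_def by force+
    then have tab: "a < t" "t < b" using t J(2) ab by (auto simp: order.strict_iff_order)
    have sub: "{a..b} \<subseteq> {0..1}" using division_ofD(2)[OF D(1) J(1)] ab by simp
    \<comment> \<open>At an interior time the derivative within the piece is a full
      derivative.\<close>
    have int: "t \<in> interior {a..b}" using tab by simp
    let ?c = "chart_at A (\<gamma> t)"
    have c: "?c \<in> charts_at A (\<gamma> t)" by (rule chart_at)
    obtain d where "((snd ?c \<circ> \<gamma>) has_vector_derivative d) (at t within {a..b})"
      using D(2)[OF J(1)] charts_atD[OF c] J(2) unfolding C1_curve_on_def ab by blast
    then have d: "((snd ?c \<circ> \<gamma>) has_vector_derivative d) (at t)"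
      by (simp add: at_within_interior[OF int])
    have "isCont \<gamma> t"
      using continuous_on_subset[OF cont sub] int by (rule continuous_on_interior)
    then show ?thesis
      using velocity_comp[OF smooth _ c d] velocity_eq_tvec[OF _ c d]
      by (simp add: tnorm_differential[OF tvec_tangent[OF c]])
  qed
  show ?thesis unfolding curve_length_def
    by (rule integral_spike[OF negligible_finite[OF \<open>finite N\<close>] eq])
qed

lemma curve_lengths_comp_subset:
  "{curve_length A g \<gamma> | \<gamma>. piecewise_C1_curve A \<gamma> \<and> \<gamma> 0 = x \<and> \<gamma> 1 = y} \<subseteq>
   {curve_length A g \<gamma> | \<gamma>. piecewise_C1_curve A \<gamma> \<and> \<gamma> 0 = F x \<and> \<gamma> 1 = F y}"
proof clarify
  fix \<gamma> assume "piecewise_C1_curve A \<gamma>" "x = \<gamma> 0" "y = \<gamma> 1"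
  then show "\<exists>\<sigma>. curve_length A g \<gamma> = curve_length A g \<sigma> \<and>
      piecewise_C1_curve A \<sigma> \<and> \<sigma> 0 = F (\<gamma> 0) \<and> \<sigma> 1 = F (\<gamma> 1)"
    by (intro exI[of _ "F \<circ> \<gamma>"]) (simp add: curve_length_comp piecewise_C1_curve_comp)
qed

text \<open>The inclusion for \<open>F\<close> and for \<open>inv F\<close> makes the two sets of
  lengths equal, so their infima agree with no discussion of bounds or nonemptiness.\<close>

lemma rdist_comp: "rdist A g (F x) (F y) = rdist A g x y"
  using curve_lengths_comp_subset[of x y]
    isometry.curve_lengths_comp_subset[OF isometry_inv, of "F x" "F y"]
  unfolding rdist_def inv_left by (simp add: subset_antisym)

end


section \<open>Naturality of the Busemann subdifferential\<close>

text \<open>\<open>h\<close> and \<open>k\<close> are mutually inverse on solutions only, which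
  suits differentials, being bijective between tangent spaces. Unique existence passes both ways;
  where it fails, both sides are defaults, matched by \<open>d\<close>.\<close>

lemma the_or_transfer:
  assumes h: "\<And>x. P x \<Longrightarrow> Q (h x)" "\<And>y. Q y \<Longrightarrow> P (k y)"
    and inv: "\<And>x. P x \<Longrightarrow> k (h x) = x" "\<And>y. Q y \<Longrightarrow> h (k y) = y"
    and d: "h d = d'"
  shows "the_or d' Q = h (the_or d P)"
proof (cases "\<exists>!x. P x")
  case True
  then obtain x where x: "P x" "\<And>z. P z \<Longrightarrow> z = x" by blast
  have "Q y \<longleftrightarrow> y = h x" for y using h inv x by metis
  then have Q: "Q = (\<lambda>y. y = h x)" by blast
  have "the_or d P = x" unfolding the_or_def if_P[OF True] by (rule the1_equality[OF True x(1)])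
  moreover have "the_or d' Q = h x" unfolding the_or_def Q by simp
  ultimately show ?thesis by simp
next
  case False
  then have "\<not> (\<exists>!y. Q y)" using h inv(1) by metis
  then show ?thesis using False d by (simp add: the_or_def)
qed

context isometry
begin

section \<open>Exponential map and logarithm\<close>

lemma geodesic_velocity:
  assumes "geodesic A g \<gamma>"
  shows "velocity A \<gamma> t \<in> tangent_space A (\<gamma> t)"
    and "velocity A (F \<circ> \<gamma>) t = differential A F (\<gamma> t) (velocity A \<gamma> t)"
proof -
  obtain d where "((snd (chart_at A (\<gamma> t)) \<circ> \<gamma>) has_vector_derivative d) (at t)"
    using geodesic_has_derivative[OF assms chart_at] by blast
  note * = geodesic_isCont[OF assms] chart_at this
  show "velocity A \<gamma> t \<in> tangent_space A (\<gamma> t)"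
    unfolding velocity_eq_tvec[OF *] by (rule tvec_tangent[OF chart_at])
  show "velocity A (F \<circ> \<gamma>) t = differential A F (\<gamma> t) (velocity A \<gamma> t)"
    by (rule velocity_comp[OF smooth *])
qed

lemma rexp_differential:
  assumes v: "v \<in> tangent_space A p"
  shows "rexp A g (F p) (differential A F p v) = F (rexp A g p v)"
proof -
  have "the_or (\<lambda>t. F p) (\<lambda>\<gamma>. geodesic A g \<gamma> \<and> \<gamma> 0 = F p \<and> velocity A \<gamma> 0 = differential A F p v)
    = F \<circ> the_or (\<lambda>t. p) (\<lambda>\<gamma>. geodesic A g \<gamma> \<and> \<gamma> 0 = p \<and> velocity A \<gamma> 0 = v)"
  proof (rule the_or_transfer[where k = "\<lambda>\<gamma>. inv F \<circ> \<gamma>"])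
    show "geodesic A g (F \<circ> \<gamma>) \<and> (F \<circ> \<gamma>) 0 = F p \<and> velocity A (F \<circ> \<gamma>) 0 = differential A F p v"
      if "geodesic A g \<gamma> \<and> \<gamma> 0 = p \<and> velocity A \<gamma> 0 = v" for \<gamma>
      using that geodesic_comp geodesic_velocity(2)[of \<gamma> 0] by auto
    show "geodesic A g (inv F \<circ> \<gamma>) \<and> (inv F \<circ> \<gamma>) 0 = p \<and> velocity A (inv F \<circ> \<gamma>) 0 = v"
      if "geodesic A g \<gamma> \<and> \<gamma> 0 = F p \<and> velocity A \<gamma> 0 = differential A F p v" for \<gamma>
      using that isometry.geodesic_comp[OF isometry_inv]
        isometry.geodesic_velocity(2)[OF isometry_inv, of \<gamma> 0] differential_inv_left[OF v]
      by (auto simp: inv_left)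
  \<comment> \<open>The default, the constant curve at \<open>p\<close>, is carried to the constant
    curve at \<open>F p\<close>.\<close>
  qed (auto simp: fun_eq_iff inv_left inv_right)
  then show ?thesis unfolding rexp_def by simp
qed

text \<open>The default \<open>tzero\<close> is tangent too, so linearity of the differential
  applies to logarithms unconditionally.\<close>

lemma exp_inv_tangent: "exp_inv A g p z \<in> tangent_space A p"
proof (cases "\<exists>!v. v \<in> tangent_space A p \<and> rexp A g p v = z")
  case True
  from theI'[OF this] show ?thesis using True by (simp add: exp_inv_def the_or_def)
next
  case False
  then show ?thesis by (simp add: exp_inv_def the_or_def tzero_tangent)
qed

lemma exp_inv_differential:
  "exp_inv A g (F p) (F z) = differential A F p (exp_inv A g p z)"
  unfolding exp_inv_def
proof (rule the_or_transfer[where k = "differential A (inv F) (F p)"])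
  show "differential A F p v \<in> tangent_space A (F p) \<and> rexp A g (F p) (differential A F p v) = F z"
    if "v \<in> tangent_space A p \<and> rexp A g p v = z" for v
    using that rexp_differential differential_tangent[OF smooth] by auto
  show "differential A (inv F) (F p) w \<in> tangent_space A p
      \<and> rexp A g p (differential A (inv F) (F p) w) = z"
    if "w \<in> tangent_space A (F p) \<and> rexp A g (F p) w = F z" for w
    using that isometry.rexp_differential[OF isometry_inv, of w "F p"]
      differential_tangent[OF smooth_inv, of w "F p"] by (simp add: inv_left)
qed (use differential_inv_left differential_inv_right[of _ "F p"] differential_tzero[OF smooth]
    in \<open>auto simp: inv_left\<close>)

section \<open>Rays, asymptotic directions and the point \<open>Y\<close>\<close>

lemma ray_differential:
  assumes "u \<in> tangent_space A p"
  shows "ray A g (F p) (differential A F p u) = F \<circ> ray A g p u"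
  by (simp add: fun_eq_iff ray_def differential_tscale[OF smooth assms, symmetric]
      rexp_differential[OF tscale_tangent[OF assms]])

lemma asymptotic_comp: "asymptotic A g (F \<circ> \<gamma>) (F \<circ> \<sigma>) \<longleftrightarrow> asymptotic A g \<gamma> \<sigma>"
  by (simp add: asymptotic_def rdist_comp)

lemma asymptotic_direction_tangent: "asymptotic_direction A g p x v \<in> tangent_space A p"
proof (cases "\<exists>!\<eta>. \<eta> \<in> tangent_space A p \<and> tnorm g p \<eta> = 1 \<and>
     asymptotic A g (ray A g p \<eta>) (ray A g x (tscale (- 1 / tnorm g x v) v))")
  case True
  from theI'[OF this] show ?thesis using True by (simp add: asymptotic_direction_def the_or_def)
next
  case False
  then show ?thesis unfolding asymptotic_direction_def the_or_def by (simp only: if_False tzero_tangent)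
qed

lemma asymptotic_direction_differential:
  assumes v: "v \<in> tangent_space A x"
  shows "asymptotic_direction A g (F p) (F x) (differential A F x v)
    = differential A F p (asymptotic_direction A g p x v)"
proof -
  let ?w = "tscale (- 1 / tnorm g x v) v"
  have w: "?w \<in> tangent_space A x" by (rule tscale_tangent[OF v])
  \<comment> \<open>Norm preservation keeps the normalising factor, so the reference ray is carried
    to the reference ray.\<close>
  have ray: "ray A g (F x) (tscale (- 1 / tnorm g (F x) (differential A F x v)) (differential A F x v))
    = F \<circ> ray A g x ?w"
    by (simp only: tnorm_differential[OF v] differential_tscale[OF smooth v, symmetric]
        ray_differential[OF w])
  \<comment> \<open>An equivalence, because the backward transport uses it as well, applied to a
    vector pulled back by \<open>inv F\<close>.\<close>
  have iff: "differential A F p \<eta> \<in> tangent_space A (F p) \<and>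
      tnorm g (F p) (differential A F p \<eta>) = 1 \<and>
      asymptotic A g (ray A g (F p) (differential A F p \<eta>)) (F \<circ> ray A g x ?w) \<longleftrightarrow>
      tnorm g p \<eta> = 1 \<and> asymptotic A g (ray A g p \<eta>) (ray A g x ?w)"
    if "\<eta> \<in> tangent_space A p" for \<eta>
    by (simp only: differential_tangent[OF smooth that] tnorm_differential[OF that]
        ray_differential[OF that] asymptotic_comp simp_thms)
  show ?thesis
    unfolding asymptotic_direction_def ray
  proof (rule the_or_transfer[where k = "differential A (inv F) (F p)"])
    show "differential A F p \<eta> \<in> tangent_space A (F p) \<and>
      tnorm g (F p) (differential A F p \<eta>) = 1 \<and>
      asymptotic A g (ray A g (F p) (differential A F p \<eta>)) (F \<circ> ray A g x ?w)"
      if "\<eta> \<in> tangent_space A p \<and> tnorm g p \<eta> = 1 \<and> asymptotic A g (ray A g p \<eta>) (ray A g x ?w)"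
      for \<eta> using that iff by blast
    show "differential A (inv F) (F p) \<zeta> \<in> tangent_space A p \<and>
      tnorm g p (differential A (inv F) (F p) \<zeta>) = 1 \<and>
      asymptotic A g (ray A g p (differential A (inv F) (F p) \<zeta>)) (ray A g x ?w)"
      if \<zeta>: "\<zeta> \<in> tangent_space A (F p) \<and> tnorm g (F p) \<zeta> = 1 \<and>
        asymptotic A g (ray A g (F p) \<zeta>) (F \<circ> ray A g x ?w)" for \<zeta>
    proof -
      have t: "differential A (inv F) (F p) \<zeta> \<in> tangent_space A p"
        using differential_tangent[OF smooth_inv, of \<zeta> "F p"] \<zeta> by (simp add: inv_left)
      have "differential A F p (differential A (inv F) (F p) \<zeta>) = \<zeta>"
        using differential_inv_right[of \<zeta> "F p"] \<zeta> by (simp add: inv_left)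
      with iff[OF t] t \<zeta> show ?thesis by simp
    qed
  qed (use differential_inv_left differential_inv_right[of _ "F p"] differential_tzero[OF smooth]
      in \<open>auto simp: inv_left\<close>)
qed

lemma differential_eq_tzero_iff:
  assumes "v \<in> tangent_space A x"
  shows "differential A F x v = tzero \<longleftrightarrow> v = tzero"
  by (metis assms differential_inv_left differential_tzero smooth smooth_inv)

lemma Y_point_differential:
  assumes v: "v \<in> tangent_space A x"
  shows "Y_point A g (F p) (F x) (differential A F x v) = F (Y_point A g p x v)"
  by (simp add: Y_point_def differential_eq_tzero_iff[OF v] tnorm_differential[OF v]
      asymptotic_direction_differential[OF v]
      differential_tscale[OF smooth asymptotic_direction_tangent, symmetric]
      rexp_differential[OF tscale_tangent[OF asymptotic_direction_tangent]])

section \<open>Busemann functions, coupling and subdifferential\<close>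

lemma busemann_differential:
  assumes u: "u \<in> tangent_space A q"
  shows "busemann A g (F q) (differential A F q u) (F x) = busemann A g q u x"
  \<comment> \<open>The functions of \<open>t\<close> under the limit coincide, so the values of
    \<open>Lim\<close> agree whether or not they converge.\<close>
  by (simp add: busemann_def tnorm_differential[OF u] differential_tscale[OF smooth u, symmetric]
      ray_differential[OF tscale_tangent[OF u]] rdist_comp)

text \<open>Injectivity of \<open>F\<close> makes the case split \<open>z = p\<close> the same on
  both sides.\<close>

lemma busemann_coupling_comp:
  "busemann_coupling A g (F p) (F z) (F y) = busemann_coupling A g p z y"
  by (simp add: busemann_coupling_def inj_eq[OF bij_is_inj[OF bij]] rdist_comp exp_inv_differential
      differential_tscale[OF smooth exp_inv_tangent, symmetric]
      busemann_differential[OF tscale_tangent[OF exp_inv_tangent]])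

lemma busemann_subdifferential_comp:
  assumes u: "u \<in> tangent_space A b"
  shows "u \<in> busemann_subdifferential A g q (f \<circ> F) b \<longleftrightarrow>
    differential A F b u \<in> busemann_subdifferential A g (F q) f (F b)"
proof -
  \<comment> \<open>Surjectivity of \<open>F\<close> turns arbitrary test points into images
    \<open>F z\<close>, to which naturality of the coupling applies.\<close>
  have all: "(\<forall>z. P z) \<longleftrightarrow> (\<forall>z. P (F z))" for P by (metis inv_right)
  show ?thesis
    unfolding busemann_subdifferential_def mem_Collect_eq Y_point_differential[OF u]
      busemann_coupling_comp
    by (subst (2) all) (simp add: u differential_tangent[OF smooth u] busemann_coupling_comp)
qed

end

theorem theorem9:
  fixes A :: "('m::{t2_space, second_countable_topology}, 'n::finite) chart set"
    and g :: "('m, 'n) metric"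
    and f :: "'m \<Rightarrow> ereal"
    and p q b :: 'm
    and I :: "'m \<Rightarrow> 'm"
    and u :: "('m, 'n) tvector"
  assumes "hadamard_manifold A g"
    and "proper_function f"
    and "riemannian_isometry A g I"
    and "I q = p"
    and "I b \<in> edom f"
    and "u \<in> tangent_space A b"
  shows "u \<in> busemann_subdifferential A g q (f \<circ> I) b \<longleftrightarrow>
         differential A I b u \<in> busemann_subdifferential A g p f (I b)"
proof -
  interpret isometry A g I
    using assms(1,3) unfolding hadamard_manifold_def riemannian_manifold_def
    by unfold_locales auto
  show ?thesis using busemann_subdifferential_comp[OF assms(6)] assms(4) by blast
qed

end
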